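(* Let $k\ge 2$ and $n\ge 1$ be integers, let $\mathcal{C}\subset(\mathbb{R}^{k+1})^{n+2}$ be the configuration space of the articulated arm of length $n+1$ in $\mathbb{R}^{k+1}$, and let $\Delta$ be the distribution on $\mathcal{C}$ given by $\Delta(q)=T_q\mathcal{C}\cap\mathcal{E}(q)$ (all defined in the context). Then: (1) $\Delta$ is a distribution of rank $k+1$ on $\mathcal{C}$. (2) $\Delta$ is a special $k$-flag on $\mathcal{C}$ of length $n+1$; that is, $\Delta$ generates a special $k$-flag $\Delta=D^{n+1}\subset D^{n}\subset\cdots\subset D^1\subset D^0=T\mathcal{C}$, where $D^{j-1}=[D^j,D^j]$.
   Context: Articulated arm. Write a point of $(\mathbb{R}^{k+1})^{n+2}$ as $q=(x_0,\dots,x_{n+1})$ with $x_i=(x_i^1,\dots,x_i^{k+1})\in\mathbb{R}^{k+1}$, and use the canonical scalar product. The configuration space is $$\mathcal{C}=\{(x_0,\dots,x_{n+1}) : \|x_i-x_{i+1}\|^2-1=0,\ i=0,\dots,n\},$$ a submanifold of dimension $(n+2)k+1$, diffeomorphic to $\mathbb{R}^{k+1}\times(\mathbb{S}^k)^{n+1}$. On $(\mathbb{R}^{k+1})^{n+2}$ consider the vector fields $$\mathcal{Z}_i=\sum_{r=1}^{k+1}(x_{i+1}^r-x_i^r)\frac{\partial}{\partial x_i^r},\quad i=0,\dots,n,$$ and let $\mathcal{E}$ be the distribution generated by $\mathcal{Z}_0,\dots,\mathcal{Z}_n,\frac{\partial}{\partial x_{n+1}^1},\dots,\frac{\partial}{\partial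 x_{n+1}^{k+1}}$. Special $k$-flags. For a distribution $D$ on a manifold, $[D,D]$ denotes the distribution generated by the vector fields tangent to $D$ and the Lie brackets $[X,Y]$ of all pairs of vector fields tangent to $D$. The Cauchy-characteristic subdistribution $L(D)\subset D$ is generated by the vector fields $X$ tangent to $D$ such that $[X,Y]$ is tangent to $D$ for every $Y$ tangent to $D$. A special $k$-flag of length $s$ on a manifold $M$ of dimension $(s+1)k+1$ is a sequence of distributions $D=D^s\subset D^{s-1}\subset\cdots\subset D^1\subset D^0=TM$ such that: (i) $D^{j-1}=[D^j,D^j]$ for $j=1,\dots,s$; (ii) $D^s,D^{s-1},\dots,D^1,D^0$ have respective (constant) ranks $k+1,2k+1,\dots,sk+1,(s+1)k+1$; (iii) for $j=1,\dots,s-1$, $L(D^j)$ is a subdistribution of constant corank one in $D^{j+1}$, and $L(D^s)=0$; (iv) there exists a completely integrable subdistribution $F\subset D^1$ of corank one in $D^1$. *)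

theory Defs
  imports "HOL-Analysis.Analysis"
begin

section \<open>Smooth maps and submanifolds of a Euclidean space\<close>

text \<open>In finite dimension, a map is \<open>C\<^sup>m\<close> on an open set iff all its iterated directional
  derivatives up to order \<open>m\<close> exist and are continuous. Used for open \<open>U\<close> only.\<close>

primrec Ck_on :: "nat \<Rightarrow> 'a::euclidean_space set \<Rightarrow> ('a \<Rightarrow> 'b::euclidean_space) \<Rightarrow> bool" where
  "Ck_on 0 U f \<longleftrightarrow> continuous_on U f"
| "Ck_on (Suc m) U f \<longleftrightarrow> (\<forall>x\<in>U. f differentiable (at x)) \<and>
     (\<forall>v. Ck_on m U (\<lambda>x. frechet_derivative f (at x) v))"

definition smooth_on :: "'a::euclidean_space set \<Rightarrow> ('a \<Rightarrow> 'b::euclidean_space) \<Rightarrow> bool" where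
  "smooth_on U f \<longleftrightarrow> (\<forall>m. Ck_on m U f)"

definition smooth_map_on :: "'a::euclidean_space set \<Rightarrow> ('a \<Rightarrow> 'b::euclidean_space) \<Rightarrow> bool" where
  "smooth_map_on S f \<longleftrightarrow>
     (\<forall>q\<in>S. \<exists>U g. open U \<and> q \<in> U \<and> smooth_on U g \<and> (\<forall>x\<in>S \<inter> U. g x = f x))"

text \<open>An embedded submanifold of dimension \<open>d\<close>: locally the common zero set of \<open>c\<close> smooth
  functions with linearly independent differentials, \<open>c\<close> being the codimension.\<close>

definition submanifold :: "nat \<Rightarrow> 'a::euclidean_space set \<Rightarrow> bool" where
  "submanifold d M \<longleftrightarrow>
     (\<exists>c. d + c = DIM('a) \<and>
       (\<forall>q\<in>M. \<exists>U (f :: nat \<Rightarrow> 'a \<Rightarrow> real).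
          open U \<and> q \<in> U \<and> (\<forall>i<c. smooth_on U (f i)) \<and>
          M \<inter> U = {x\<in>U. \<forall>i<c. f i x = 0} \<and>
          (\<forall>x\<in>M \<inter> U. \<forall>a :: nat \<Rightarrow> real.
             (\<forall>v. (\<Sum>i<c. a i * frechet_derivative (f i) (at x) v) = 0) \<longrightarrow> (\<forall>i<c. a i = 0))))"

definition tangent_space :: "'a::euclidean_space set \<Rightarrow> 'a \<Rightarrow> 'a set" where
  "tangent_space M q =
     {v. \<exists>(\<gamma> :: real \<Rightarrow> 'a) e. e > 0 \<and> smooth_on {-e<..<e} \<gamma> \<and> \<gamma> ` {-e<..<e} \<subseteq> M \<and>
           \<gamma> 0 = q \<and> (\<gamma> has_vector_derivative v) (at 0)}"

section \<open>Distributions\<close>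

text \<open>Vector fields on \<open>M\<close> are maps from the ambient space to itself of which only the values
  on \<open>M\<close> matter; a distribution assigns to each point of \<open>M\<close> a subspace of the tangent space
  (again, values off \<open>M\<close> are irrelevant).\<close>

definition distribution_on :: "'a::euclidean_space set \<Rightarrow> nat \<Rightarrow> ('a \<Rightarrow> 'a set) \<Rightarrow> bool" where
  "distribution_on M r D \<longleftrightarrow>
     (\<forall>q\<in>M. subspace (D q) \<and> D q \<subseteq> tangent_space M q \<and> dim (D q) = r) \<and>
     (\<forall>q\<in>M. \<exists>U \<X>. open U \<and> q \<in> U \<and> (\<forall>X\<in>\<X>. smooth_map_on (M \<inter> U) X) \<and>
        (\<forall>p\<in>M \<inter> U. D p = span {X p | X. X \<in> \<X>}))"

definition tangent_fields :: "'a::euclidean_space set \<Rightarrow> ('a \<Rightarrow> 'a set) \<Rightarrow> ('a \<Rightarrow> 'a) set" where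
  "tangent_fields M D = {X. smooth_map_on M X \<and> (\<forall>q\<in>M. X q \<in> D q)}"

text \<open>The derivative of a smooth map within a submanifold is not unique as a linear map on the
  ambient space, but its values on tangent vectors of the submanifold are, and for tangent
  fields \<open>X\<close>, \<open>Y\<close> only these are used here.\<close>

definition lie_bracket ::
  "'a::euclidean_space set \<Rightarrow> ('a \<Rightarrow> 'a) \<Rightarrow> ('a \<Rightarrow> 'a) \<Rightarrow> 'a \<Rightarrow> 'a" where
  "lie_bracket M X Y q =
     frechet_derivative Y (at q within M) (X q) - frechet_derivative X (at q within M) (Y q)"

definition bracket_dist :: "'a::euclidean_space set \<Rightarrow> ('a \<Rightarrow> 'a set) \<Rightarrow> 'a \<Rightarrow> 'a set" where
  "bracket_dist M D q =
     span ({X q | X. X \<in> tangent_fields M D} \<union>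
           {lie_bracket M X Y q | X Y. X \<in> tangent_fields M D \<and> Y \<in> tangent_fields M D})"

definition cauchy_char :: "'a::euclidean_space set \<Rightarrow> ('a \<Rightarrow> 'a set) \<Rightarrow> 'a \<Rightarrow> 'a set" where
  "cauchy_char M D q =
     span {X q | X. X \<in> tangent_fields M D \<and>
       (\<forall>Y\<in>tangent_fields M D. \<forall>p\<in>M. lie_bracket M X Y p \<in> D p)}"

definition completely_integrable :: "'a::euclidean_space set \<Rightarrow> nat \<Rightarrow> ('a \<Rightarrow> 'a set) \<Rightarrow> bool" where
  "completely_integrable M r F \<longleftrightarrow>
     (\<forall>q\<in>M. \<exists>N. q \<in> N \<and> N \<subseteq> M \<and> submanifold r N \<and> (\<forall>p\<in>N. tangent_space N p = F p))"

definition special_flag ::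
  "nat \<Rightarrow> nat \<Rightarrow> 'a::euclidean_space set \<Rightarrow> (nat \<Rightarrow> 'a \<Rightarrow> 'a set) \<Rightarrow> bool" where
  "special_flag k s M D \<longleftrightarrow>
     submanifold ((s + 1) * k + 1) M \<and>
     (\<forall>q\<in>M. D 0 q = tangent_space M q) \<and>
     (\<forall>j\<in>{1..s}. \<forall>q\<in>M. D j q \<subseteq> D (j - 1) q) \<and>
     (\<forall>j\<in>{1..s}. \<forall>q\<in>M. D (j - 1) q = bracket_dist M (D j) q) \<and>
     (\<forall>j\<le>s. distribution_on M ((s - j + 1) * k + 1) (D j)) \<and>
     (\<forall>j\<in>{1..<s}. \<forall>q\<in>M. cauchy_char M (D j) q \<subseteq> D (j + 1) q \<and>
        dim (cauchy_char M (D j) q) + 1 = dim (D (j + 1) q)) \<and>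
     (\<forall>q\<in>M. cauchy_char M (D s) q = {0}) \<and>
     (\<exists>F r. distribution_on M r F \<and> completely_integrable M r F \<and>
        (\<forall>q\<in>M. F q \<subseteq> D 1 q \<and> dim (F q) + 1 = dim (D 1 q)))"

definition generates_special_flag ::
  "nat \<Rightarrow> nat \<Rightarrow> 'a::euclidean_space set \<Rightarrow> ('a \<Rightarrow> 'a set) \<Rightarrow> bool" where
  "generates_special_flag k s M \<Delta> \<longleftrightarrow>
     (\<exists>D. (\<forall>q\<in>M. D s q = \<Delta> q) \<and> special_flag k s M D)"

section \<open>The articulated arm\<close>

text \<open>The index type \<open>'m\<close> of the joints has \<open>n + 2\<close> elements, listed in order by
  \<open>ix 0, \<dots>, ix (n + 1)\<close>; so the joint \<open>x\<^sub>i\<close> of the configuration \<open>q\<close> is \<open>q $ ix i\<close> and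
  its \<open>r\<close>-th coordinate is \<open>q $ ix i $ r\<close>.\<close>

definition config_space :: "nat \<Rightarrow> (nat \<Rightarrow> 'm::finite) \<Rightarrow> ((real^'d)^'m) set" where
  "config_space n ix = {q. \<forall>i\<in>{0..n}. (norm (q $ ix i - q $ ix (i + 1)))\<^sup>2 - 1 = 0}"

definition coord_field :: "'m::finite \<Rightarrow> 'd::finite \<Rightarrow> (real^'d)^'m" where
  "coord_field a r = axis a (axis r 1)"

definition arm_Z :: "(nat \<Rightarrow> 'm::finite) \<Rightarrow> nat \<Rightarrow> (real^'d)^'m \<Rightarrow> (real^'d)^'m" where
  "arm_Z ix i q = (\<Sum>r\<in>UNIV. (q $ ix (i + 1) $ r - q $ ix i $ r) *\<^sub>R coord_field (ix i) r)"

definition arm_E :: "nat \<Rightarrow> (nat \<Rightarrow> 'm::finite) \<Rightarrow> (real^'d)^'m \<Rightarrow> ((real^'d)^'m) set" where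
  "arm_E n ix q =
     span ({arm_Z ix i q | i. i \<in> {0..n}} \<union> {coord_field (ix (n + 1)) r | r. r \<in> UNIV})"

definition arm_dist :: "nat \<Rightarrow> (nat \<Rightarrow> 'm::finite) \<Rightarrow> (real^'d)^'m \<Rightarrow> ((real^'d)^'m) set" where
  "arm_dist n ix q = tangent_space (config_space n ix) q \<inter> arm_E n ix q"

end

theory Submission
  imports Defs
begin

text \<open>
  Write \<open>u\<^sub>i = x\<^bsub>i+1\<^esub> - x\<^sub>i\<close> for the unit links. A vector \<open>v\<close> is tangent to the configuration space iff
  \<open>u\<^sub>i \<bullet> (v\<^bsub>i+1\<^esub> - v\<^sub>i) = 0\<close> for all \<open>i \<le> n\<close>. The flag is
  \<open>D\<^sup>j = {v tangent. v\<^sub>i = (u\<^sub>i \<bullet> v\<^bsub>i+1\<^esub>) u\<^sub>i for i < j}\<close>, and its Cauchy characteristics are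
  \<open>K\<^sup>j = {v tangent. v\<^sub>i = 0 for i \<le> j}\<close>, while \<open>K\<^sup>0\<close> is integrable with leaves \<open>x\<^sub>0 = const\<close>.
  Everything rests on one formula: differentiating the equations of \<open>D\<^sup>j\<close> shows that the bracket \<open>Z\<close> of
  fields \<open>X\<close>, \<open>Y\<close> tangent to \<open>D\<^sup>j\<close> is tangent and, for \<open>i < j\<close>,
  \<open>Z\<^sub>i = (u\<^sub>i \<bullet> Z\<^bsub>i+1\<^esub>) u\<^sub>i + (u\<^sub>i \<bullet> Y\<^bsub>i+1\<^esub>) X\<^bsub>i+1\<^esub> - (u\<^sub>i \<bullet> X\<^bsub>i+1\<^esub>) Y\<^bsub>i+1\<^esub>\<close>.
  The last two terms cancel for \<open>i + 1 < j\<close>, so brackets lie in \<open>D\<^bsup>j-1\<^esup>\<close>; at \<open>i = j - 1\<close> the vectors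
  \<open>X\<^sub>j\<close>, \<open>Y\<^sub>j\<close> are arbitrary, so brackets fill \<open>D\<^bsup>j-1\<^esup>\<close> and \<open>X\<close> is characteristic iff \<open>X\<^sub>j = 0\<close>.
  Both families are spanned by globally defined polynomial vector fields.
\<close>

section \<open>Smooth maps\<close>

text \<open>Since \<open>U\<close> is open, derivatives at its points see only values on
  \<open>U\<close>; the induction passes this on to the iterated derivatives.\<close>

lemma Ck_on_cong:
  assumes "open U" and "\<And>x. x \<in> U \<Longrightarrow> f x = g x"
  shows "Ck_on m U f \<longleftrightarrow> Ck_on m U g"
  using assms(2)
proof (induction m arbitrary: f g)
  case 0
  then show ?case by (simp cong: continuous_on_cong)
next
  case (Suc m)
  have der: "(f has_derivative D) (at x) \<longleftrightarrow> (g has_derivative D) (at x)" if "x \<in> U" for x D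
    using has_derivative_transform_within_open[OF _ assms(1) that, of f D UNIV g]
      has_derivative_transform_within_open[OF _ assms(1) that, of g D UNIV f] Suc.prems by auto
  have "frechet_derivative f (at x) = frechet_derivative g (at x)" if "x \<in> U" for x
    unfolding frechet_derivative_def using der[OF that] by simp
  then have "Ck_on m U (\<lambda>x. frechet_derivative f (at x) v) \<longleftrightarrow>
      Ck_on m U (\<lambda>x. frechet_derivative g (at x) v)" for v
    by (intro Suc.IH) simp
  moreover have "f differentiable (at x) \<longleftrightarrow> g differentiable (at x)" if "x \<in> U" for x
    unfolding differentiable_def using der[OF that] by simp
  ultimately show ?case by simp
qed

text \<open>Any explicitly known derivative may replace the chosen
  \<open>frechet_derivative\<close>, because derivatives at a point are unique.\<close>

lemma Ck_on_SucI:
  assumes "open U" and "\<And>x. x \<in> U \<Longrightarrow> (f has_derivative f' x) (at x)"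
    and "\<And>v. Ck_on m U (\<lambda>x. f' x v)"
  shows "Ck_on (Suc m) U f"
proof -
  have "frechet_derivative f (at x) = f' x" if "x \<in> U" for x
    using frechet_derivative_at[OF assms(2)[OF that]] by simp
  then have "Ck_on m U (\<lambda>x. frechet_derivative f (at x) v)" for v
    using assms(3)[of v] by (subst Ck_on_cong[OF assms(1)]) auto
  then show ?thesis using assms(2) by (auto simp: differentiable_def)
qed

lemma Ck_on_SucD:
  assumes "Ck_on (Suc m) U f"
  shows "x \<in> U \<Longrightarrow> (f has_derivative frechet_derivative f (at x)) (at x)"
    and "Ck_on m U (\<lambda>x. frechet_derivative f (at x) v)"
  using assms by (auto simp: frechet_derivative_works)

lemma Ck_on_Suc_imp:
  assumes "open U" and "Ck_on (Suc m) U f"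
  shows "Ck_on m U f"
  using assms(2)
proof (induction m arbitrary: f)
  case 0
  then show ?case
    by (auto intro!: continuous_at_imp_continuous_on differentiable_imp_continuous_within)
next
  case (Suc m)
  show ?case
    by (rule Ck_on_SucI[OF assms(1) Ck_on_SucD(1)[OF Suc.prems]])
      (auto intro: Suc.IH Ck_on_SucD(2)[OF Suc.prems])
qed

lemma Ck_on_const: "open U \<Longrightarrow> Ck_on m U (\<lambda>_. c)"
proof (induction m arbitrary: c)
  case (Suc m)
  then show ?case
    by (intro Ck_on_SucI[where f' = "\<lambda>_ _. 0"]) auto
qed simp

lemma Ck_on_add:
  assumes "open U" "Ck_on m U f" "Ck_on m U g"
  shows "Ck_on m U (\<lambda>x. f x + g x)"
  using assms(2,3)
proof (induction m arbitrary: f g)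
  case (Suc m)
  show ?case
    by (rule Ck_on_SucI[OF assms(1)
        has_derivative_add[OF Ck_on_SucD(1)[OF Suc.prems(1)] Ck_on_SucD(1)[OF Suc.prems(2)]]])
      (auto intro: Suc.IH Ck_on_SucD(2)[OF Suc.prems(1)] Ck_on_SucD(2)[OF Suc.prems(2)])
qed (auto intro: continuous_intros)

lemma Ck_on_bounded_linear:
  assumes "open U" "bounded_linear h" "Ck_on m U f"
  shows "Ck_on m U (\<lambda>x. h (f x))"
  using assms(3)
proof (induction m arbitrary: f)
  case 0
  then show ?case using assms(2) by (auto intro: bounded_linear.continuous_on)
next
  case (Suc m)
  show ?case
    by (rule Ck_on_SucI[OF assms(1)
        bounded_linear.has_derivative[OF assms(2) Ck_on_SucD(1)[OF Suc.prems]]])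
      (auto intro: Suc.IH Ck_on_SucD(2)[OF Suc.prems])
qed

text \<open>By the Leibniz rule the derivative is a sum of products of one derivative and one
  undifferentiated factor; the latter is first lowered from order \<open>Suc m\<close> to
  \<open>m\<close>.\<close>

lemma Ck_on_bounded_bilinear:
  assumes "open U" "bounded_bilinear h" "Ck_on m U f" "Ck_on m U g"
  shows "Ck_on m U (\<lambda>x. h (f x) (g x))"
  using assms(3,4)
proof (induction m arbitrary: f g)
  case 0
  then show ?case using assms(2) by (auto intro: bounded_bilinear.continuous_on)
next
  case (Suc m)
  show ?case
    by (rule Ck_on_SucI[OF assms(1) bounded_bilinear.FDERIV[OF assms(2)
        Ck_on_SucD(1)[OF Suc.prems(1)] Ck_on_SucD(1)[OF Suc.prems(2)]]])
      (auto intro!: Ck_on_add assms(1) Suc.IH Ck_on_SucD(2)[OF Suc.prems(1)]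
        Ck_on_SucD(2)[OF Suc.prems(2)] Ck_on_Suc_imp[OF assms(1) Suc.prems(1)]
        Ck_on_Suc_imp[OF assms(1) Suc.prems(2)])
qed

lemma Ck_on_id: "open U \<Longrightarrow> Ck_on m U (\<lambda>x. x)"
proof (induction m)
  case (Suc m)
  then show ?case
    by (intro Ck_on_SucI[where f' = "\<lambda>_ v. v"]) (auto intro: Ck_on_const)
qed (auto intro: continuous_intros)

text \<open>Each function is, up to a factor, the derivative of the other, so one induction treats
  both. The factor \<open>c\<close> will be the angular speed of a link.\<close>

lemma Ck_on_cos_sin:
  fixes c :: real
  assumes "open U"
  shows "Ck_on m U (\<lambda>t. cos (c * t)) \<and> Ck_on m U (\<lambda>t. sin (c * t))"
proof (induction m)
  case 0
  then show ?case by (auto intro!: continuous_intros)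
next
  case (Suc m)
  have "bounded_linear (\<lambda>y::real. (v * - c) * y)" for v
    by (intro bounded_linear_intros)
  from Ck_on_bounded_linear[OF assms this] Suc
  have "Ck_on m U (\<lambda>t. (v * - c) * sin (c * t))" for v by auto
  moreover have "bounded_linear (\<lambda>y::real. (v * c) * y)" for v
    by (intro bounded_linear_intros)
  from Ck_on_bounded_linear[OF assms this] Suc
  have "Ck_on m U (\<lambda>t. (v * c) * cos (c * t))" for v by auto
  ultimately show ?case
    by (intro conjI Ck_on_SucI[OF assms, where f' = "\<lambda>t v. (v * - c) * sin (c * t)"]
        Ck_on_SucI[OF assms, where f' = "\<lambda>t v. (v * c) * cos (c * t)"])
      (auto intro!: derivative_eq_intros)
qed

section \<open>Closure properties of smooth maps\<close>

lemma smooth_on_const: "open U \<Longrightarrow> smooth_on U (\<lambda>_. c)"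
  by (simp add: smooth_on_def Ck_on_const)

lemma smooth_on_id: "open U \<Longrightarrow> smooth_on U (\<lambda>x. x)"
  by (simp add: smooth_on_def Ck_on_id)

lemma smooth_on_add:
  "open U \<Longrightarrow> smooth_on U f \<Longrightarrow> smooth_on U g \<Longrightarrow> smooth_on U (\<lambda>x. f x + g x)"
  by (simp add: smooth_on_def Ck_on_add)

lemma smooth_on_bounded_linear:
  "open U \<Longrightarrow> bounded_linear h \<Longrightarrow> smooth_on U f \<Longrightarrow> smooth_on U (\<lambda>x. h (f x))"
  by (simp add: smooth_on_def Ck_on_bounded_linear)

lemma smooth_on_bounded_bilinear:
  "open U \<Longrightarrow> bounded_bilinear h \<Longrightarrow> smooth_on U f \<Longrightarrow> smooth_on U g \<Longrightarrow>
    smooth_on U (\<lambda>x. h (f x) (g x))"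
  by (simp add: smooth_on_def Ck_on_bounded_bilinear)

lemmas smooth_on_inner = smooth_on_bounded_bilinear[OF _ bounded_bilinear_inner]
lemmas smooth_on_scaleR = smooth_on_bounded_bilinear[OF _ bounded_bilinear_scaleR]

lemma smooth_on_diff:
  "open U \<Longrightarrow> smooth_on U f \<Longrightarrow> smooth_on U g \<Longrightarrow> smooth_on U (\<lambda>x. f x - g x)"
  using smooth_on_add[of U f "\<lambda>x. - g x"]
    smooth_on_bounded_linear[OF _ bounded_linear_minus[OF bounded_linear_ident], of U g] by simp

lemma smooth_on_sum:
  assumes "open U" and "\<And>i. i \<in> I \<Longrightarrow> smooth_on U (f i)"
  shows "smooth_on U (\<lambda>x. \<Sum>i\<in>I. f i x)"
  using assms(2)
proof (induction I rule: infinite_finite_induct)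
  case (insert i I)
  then show ?case using smooth_on_add[OF assms(1), of "f i"] by simp
qed (simp_all add: smooth_on_const[OF assms(1)])

lemma smooth_on_cos: "open U \<Longrightarrow> smooth_on U (\<lambda>t::real. cos (c * t))"
  and smooth_on_sin: "open U \<Longrightarrow> smooth_on U (\<lambda>t::real. sin (c * t))"
  by (simp_all add: smooth_on_def Ck_on_cos_sin)

section \<open>Derivatives within a submanifold\<close>

lemma smooth_on_imp_has_derivative:
  assumes "smooth_on U f" "x \<in> U"
  shows "(f has_derivative frechet_derivative f (at x)) (at x)"
  using Ck_on_SucD(1)[of 0 U f x] assms by (simp only: smooth_on_def)

lemma smooth_on_imp_smooth_map_on: "smooth_on UNIV f \<Longrightarrow> smooth_map_on S f"
  unfolding smooth_map_on_def by (intro ballI exI[of _ UNIV] exI[of _ f]) simp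

text \<open>A local smooth extension provides some derivative within \<open>M\<close>. Although it
  need not be unique, the one selected by \<open>frechet_derivative\<close> is then a genuine
  derivative.\<close>

lemma smooth_map_on_has_derivative:
  assumes "smooth_map_on M f" "q \<in> M"
  shows "(f has_derivative frechet_derivative f (at q within M)) (at q within M)"
proof -
  obtain U g where U: "open U" "q \<in> U" and g: "smooth_on U g" "\<forall>x\<in>M \<inter> U. g x = f x"
    using bspec[OF assms(1)[unfolded smooth_map_on_def] assms(2)] by (elim exE conjE)
  have "(g has_derivative frechet_derivative g (at q)) (at q within M)"
    using smooth_on_imp_has_derivative[OF g(1) U(2)] has_derivative_at_withinI by blast
  then have "(g has_derivative frechet_derivative g (at q)) (at q within M \<inter> U)"
    using has_derivative_subset by blast
  then have "(f has_derivative frechet_derivative g (at q)) (at q within M \<inter> U)"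
    by (rule has_derivative_transform[rotated 2]) (use assms U g in auto)
  then have "(f has_derivative frechet_derivative g (at q)) (at q within M)"
    using at_within_nhd[OF U(2,1), of "M \<inter> U" M] by simp
  then show ?thesis
    by (metis differentiable_def frechet_derivative_works)
qed

text \<open>Composing with a curve in \<open>M\<close> of velocity \<open>v\<close> turns both sides
  into derivatives of the same function of one variable. This allows identities valid only on
  \<open>M\<close> to be differentiated in tangent directions.\<close>

lemma has_derivative_within_unique_on_tangent:
  assumes f: "(f has_derivative f') (at q within M)" and g: "(g has_derivative g') (at q within M)"
    and eq: "\<And>x. x \<in> M \<Longrightarrow> f x = g x" and v: "v \<in> tangent_space M q"
  shows "f' v = g' v"
proof -
  obtain \<gamma> e where e: "e > 0" and im: "\<gamma> ` {-e<..<e} \<subseteq> M" and q: "\<gamma> 0 = q"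
    and \<gamma>: "(\<gamma> has_vector_derivative v) (at 0)"
    using v unfolding tangent_space_def by blast
  have 0: "0 \<in> {-e<..<e}" using e by simp
  have \<gamma>': "(\<gamma> has_vector_derivative v) (at 0 within {-e<..<e})"
    using \<gamma> has_vector_derivative_at_within by blast
  have chain: "(h \<circ> \<gamma> has_vector_derivative h' v) (at 0)"
    if "(h has_derivative h') (at q within M)" for h :: "'a \<Rightarrow> 'b" and h'
  proof -
    have "(h has_derivative h') (at (\<gamma> 0) within \<gamma> ` {-e<..<e})"
      using that im q has_derivative_subset by blast
    from vector_derivative_diff_chain_within[OF \<gamma>' this] show ?thesis
      using at_within_open[OF 0] by simp
  qed
  have "((g \<circ> \<gamma>) has_vector_derivative f' v) (at 0)"
  proof (rule has_vector_derivative_transform_within_open[OF chain[OF f] _ 0])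
    show "(f \<circ> \<gamma>) t = (g \<circ> \<gamma>) t" if "t \<in> {-e<..<e}" for t
      using eq[of "\<gamma> t"] im that by (simp add: image_subset_iff)
  qed simp
  then show ?thesis using chain[OF g] vector_derivative_unique_at by blast
qed

section \<open>Linear algebra, distributions and submanifolds\<close>

text \<open>Rank-nullity on a subspace: the orthogonal complement \<open>T\<close> of the kernel in
  \<open>S\<close> is mapped injectively onto the image of \<open>S\<close>.\<close>

lemma dim_eq_image_plus_kernel:
  fixes f :: "'a::euclidean_space \<Rightarrow> 'b::euclidean_space"
  assumes f: "linear f" and S: "subspace S"
  shows "dim S = dim (f ` S) + dim {x \<in> S. f x = 0}"
proof -
  define K where "K = {x \<in> S. f x = 0}"
  define T where "T = {y \<in> S. \<forall>x\<in>K. orthogonal x y}"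
  have K: "subspace K" "K \<subseteq> S"
    using S f by (auto simp: K_def subspace_def linear_add linear_scale linear_0)
  have T: "subspace T"
    using S by (auto simp: T_def subspace_def orthogonal_def inner_simps)
  have dim: "dim T + dim K = dim S"
    using dim_subspace_orthogonal_to_vectors[OF K(1) S K(2)] by (simp add: T_def)
  have inj: "inj_on f T"
  proof (rule inj_onI)
    fix x y assume xy: "x \<in> T" "y \<in> T" "f x = f y"
    then have "x - y \<in> T" using T subspace_diff by blast
    moreover have "f (x - y) = 0" using xy f by (simp add: linear_diff)
    ultimately have "orthogonal (x - y) (x - y)" by (auto simp: T_def K_def)
    then show "x = y" by (simp add: orthogonal_self)
  qed
  have "f ` S \<subseteq> f ` T"
  proof
    fix z assume "z \<in> f ` S"
    then obtain x where x: "x \<in> S" "z = f x" by blast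
    obtain y w where yw: "y \<in> span K" "\<And>u. u \<in> span K \<Longrightarrow> orthogonal w u" "x = y + w"
      using orthogonal_subspace_decomp_exists[of K x] by metis
    have y: "y \<in> K" using yw K(1) by (metis span_eq_iff)
    then have "w \<in> S" using x yw(3) K(2) S subspace_diff[of S x y] by auto
    then have "w \<in> T"
      using yw(2) by (auto simp: T_def span_base orthogonal_commute)
    moreover have "z = f w" using x yw(3) y f by (simp add: linear_add K_def)
    ultimately show "z \<in> f ` T" by blast
  qed
  then have "f ` S = f ` T" by (auto simp: T_def)
  moreover have "inj_on f (span T)" using inj T by (metis span_eq_iff)
  then have "dim (f ` T) = dim T" by (rule dim_image_eq[OF f])
  ultimately show ?thesis using dim by (simp add: K_def)
qed

lemma bounded_linear_axis: "bounded_linear (axis i :: 'a::euclidean_space \<Rightarrow> 'a^'n)"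
  by (intro linear_conv_bounded_linear[THEN iffD1] linearI) (auto simp: vec_eq_iff axis_def)

lemma distribution_on_cong:
  assumes "\<And>q. q \<in> M \<Longrightarrow> D q = E q"
  shows "distribution_on M r D \<longleftrightarrow> distribution_on M r E"
  using assms unfolding distribution_on_def by simp

text \<open>If every vector of \<open>D\<close> extends to a global tangent field, the family of all
  tangent fields generates \<open>D\<close>, with \<open>UNIV\<close> as the neighbourhood of every
  point.\<close>

lemma distribution_onI:
  assumes "\<And>q. q \<in> M \<Longrightarrow> subspace (D q) \<and> D q \<subseteq> tangent_space M q \<and> dim (D q) = r"
    and "\<And>q v. q \<in> M \<Longrightarrow> v \<in> D q \<Longrightarrow> \<exists>X\<in>tangent_fields M D. X q = v"
  shows "distribution_on M r D"
proof -
  have "D p = span {X p | X. X \<in> tangent_fields M D}" if "p \<in> M" for p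
  proof (intro equalityI)
    show "D p \<subseteq> span {X p | X. X \<in> tangent_fields M D}"
      using assms(2)[OF that] by (fastforce intro: span_base)
    show "span {X p | X. X \<in> tangent_fields M D} \<subseteq> D p"
      using assms(1)[OF that] that by (intro span_minimal) (auto simp: tangent_fields_def)
  qed
  then show ?thesis
    unfolding distribution_on_def using assms(1)
    by (intro conjI ballI exI[of _ UNIV] exI[of _ "tangent_fields M D"])
      (auto simp: tangent_fields_def)
qed

text \<open>Independence of the differentials follows from dual vectors: evaluating a vanishing
  combination at the \<open>i\<close>-th one isolates its \<open>i\<close>-th coefficient.\<close>

lemma submanifoldI:
  fixes f :: "nat \<Rightarrow> 'a::euclidean_space \<Rightarrow> real"
  assumes "d + c = DIM('a)" and "\<And>i. i < c \<Longrightarrow> smooth_on UNIV (f i)"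
    and M: "M = {x. \<forall>i<c. f i x = 0}"
    and dual: "\<And>x i. x \<in> M \<Longrightarrow> i < c \<Longrightarrow>
      \<exists>v. \<forall>j<c. frechet_derivative (f j) (at x) v = (if j = i then 1 else 0)"
  shows "submanifold d M"
proof -
  have "a i = 0" if x: "x \<in> M" and i: "i < c"
    and a: "\<forall>v. (\<Sum>i<c. a i * frechet_derivative (f i) (at x) v) = 0" for x i a
  proof -
    obtain v where v: "\<forall>j<c. frechet_derivative (f j) (at x) v = (if j = i then 1 else 0)"
      using dual[OF x i] by blast
    have "(\<Sum>j<c. a j * frechet_derivative (f j) (at x) v) = (\<Sum>j<c. if j = i then a j else 0)"
      using v by (intro sum.cong) auto
    then show ?thesis using a i by simp
  qed
  then show ?thesis
    unfolding submanifold_def using assms(1,2)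
    by (intro exI[of _ c] conjI ballI exI[of _ UNIV] exI[of _ f]) (auto simp: M)
qed

section \<open>Configurations of the arm\<close>

locale arm =
  fixes n :: nat and ix :: "nat \<Rightarrow> 'm::finite"
  assumes ix: "bij_betw ix {0..n + 1} UNIV"
begin

definition link :: "nat \<Rightarrow> (real^'d)^'m \<Rightarrow> real^'d" where
  "link i q = q $ ix (Suc i) - q $ ix i"

text \<open>Builds a configuration or a velocity from a sequence indexed by position, so that
  recursion along the arm runs over \<open>nat\<close> and not over the abstract index type.\<close>

definition assemble :: "(nat \<Rightarrow> real^'d) \<Rightarrow> (real^'d)^'m" where
  "assemble f = (\<chi> m. f (the_inv_into {0..n + 1} ix m))"

definition tangent :: "(real^'d)^'m \<Rightarrow> ((real^'d)^'m) set" where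
  "tangent q = {v. \<forall>i\<le>n. link i q \<bullet> link i v = 0}"

text \<open>For tangent vectors the condition says that \<open>v $ ix i\<close> is parallel to
  \<open>link i q\<close>, since tangency determines the coefficient. Writing the coefficient out
  makes it an equation that can be differentiated.\<close>

definition flag :: "nat \<Rightarrow> (real^'d)^'m \<Rightarrow> ((real^'d)^'m) set" where
  "flag j q = {v \<in> tangent q. \<forall>i<j. v $ ix i = (link i q \<bullet> v $ ix (Suc i)) *\<^sub>R link i q}"

definition fixing :: "nat \<Rightarrow> (real^'d)^'m \<Rightarrow> ((real^'d)^'m) set" where
  "fixing j q = {v \<in> tangent q. \<forall>i\<le>j. v $ ix i = 0}"

abbreviation C :: "((real^'d)^'m) set" where
  "C \<equiv> config_space n ix"

lemma assemble_nth [simp]: "i \<le> Suc n \<Longrightarrow> assemble f $ ix i = f i"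
  using the_inv_into_f_f[OF bij_betw_imp_inj_on[OF ix], of i] by (simp add: assemble_def)

lemma joint_cases: obtains i where "i \<le> Suc n" "m = ix i"
  using bij_betw_imp_surj_on[OF ix] by (metis Suc_eq_plus1 UNIV_I atLeastAtMost_iff imageE)

lemma joints_eqI: "(\<And>i. i \<le> Suc n \<Longrightarrow> v $ ix i = w $ ix i) \<Longrightarrow> v = w"
  by (metis joint_cases vec_eq_iff)

lemma ix_eq_iff: "i \<le> Suc n \<Longrightarrow> j \<le> Suc n \<Longrightarrow> ix i = ix j \<longleftrightarrow> i = j"
  using bij_betw_imp_inj_on[OF ix] by (simp add: inj_on_eq_iff)

lemma card_joints: "CARD('m) = n + 2"
  using bij_betw_same_card[OF ix] by simp

lemma link_add [simp]: "link i (v + w) = link i v + link i w"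
  and link_diff [simp]: "link i (v - w) = link i v - link i w"
  and link_scaleR [simp]: "link i (c *\<^sub>R v) = c *\<^sub>R link i v"
  and link_zero [simp]: "link i 0 = 0"
  by (simp_all add: link_def algebra_simps)

lemma link_assemble [simp]: "i \<le> n \<Longrightarrow> link i (assemble f) = f (Suc i) - f i"
  by (simp add: link_def)

lemma joint_link: "q $ ix (Suc i) = q $ ix i + link i q"
  by (simp add: link_def)

lemma bounded_linear_joint: "bounded_linear (\<lambda>q::(real^'d)^'m. q $ m)"
  by (rule bounded_linear_vec_nth)

lemma bounded_linear_link: "bounded_linear (link i)"
  unfolding link_def by (intro bounded_linear_intros bounded_linear_sub bounded_linear_joint)

lemma mem_C_iff:
  fixes q :: "(real^'d)^'m"
  shows "q \<in> C \<longleftrightarrow> (\<forall>i\<le>n. norm (link i q) = 1)"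
proof -
  have "(norm x)\<^sup>2 - 1 = 0 \<longleftrightarrow> norm x = 1" for x :: "real^'d"
    by (smt (verit) norm_ge_zero power2_eq_1_iff)
  then show ?thesis
    by (auto simp: config_space_def link_def norm_minus_commute)
qed

lemma inner_link_self: "q \<in> C \<Longrightarrow> i \<le> n \<Longrightarrow> link i q \<bullet> link i q = 1"
  by (simp add: mem_C_iff norm_eq_1)

lemma link_nonzero: "q \<in> C \<Longrightarrow> i \<le> n \<Longrightarrow> link i q \<noteq> 0"
  using inner_link_self[of q i] by auto

lemma smooth_on_link: "open U \<Longrightarrow> smooth_on U (link i)"
  using smooth_on_bounded_linear[OF _ bounded_linear_link smooth_on_id] by blast

text \<open>Reduces smoothness and differentiation of assembled maps to the linear embeddings
  \<open>axis\<close>.\<close>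

lemma assemble_eq_sum: "assemble f = (\<Sum>i\<le>Suc n. axis (ix i) (f i))"
proof (rule joints_eqI)
  fix i assume i: "i \<le> Suc n"
  have "(\<Sum>l\<le>Suc n. axis (ix l) (f l)) $ ix i = (\<Sum>l\<le>Suc n. if l = i then f l else 0)"
    using i by (auto simp: axis_def ix_eq_iff intro!: sum.cong)
  then show "assemble f $ ix i = (\<Sum>l\<le>Suc n. axis (ix l) (f l)) $ ix i"
    using i by simp
qed

lemma smooth_on_assemble:
  assumes "open U" and "\<And>i. i \<le> Suc n \<Longrightarrow> smooth_on U (f i)"
  shows "smooth_on U (\<lambda>x. assemble (\<lambda>i. f i x))"
  unfolding assemble_eq_sum using assms
  by (intro smooth_on_sum smooth_on_bounded_linear[OF _ bounded_linear_axis]) auto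

section \<open>The subspaces of the flag and their spanning fields\<close>

lemma subspace_tangent: "subspace (tangent q)"
  by (auto simp: subspace_def tangent_def inner_simps)

lemma subspace_flag: "subspace (flag j q)"
  using subspace_tangent[of q] unfolding subspace_def flag_def by (auto simp: inner_simps algebra_simps)

lemma subspace_fixing: "subspace (fixing j q)"
  using subspace_tangent[of q] unfolding subspace_def fixing_def by auto

text \<open>If joint \<open>i\<close> rests, tangency makes the velocity of joint
  \<open>i + 1\<close> orthogonal to link \<open>i\<close>, so both sides of the flag equation
  vanish. This holds at \<open>i = j\<close> as well, which gains one step in the flag.\<close>

lemma fixing_subset_flag:
  assumes "j \<le> n"
  shows "fixing j q \<subseteq> flag (Suc j) q"
proof
  fix v assume v: "v \<in> fixing j q"
  have "v $ ix i = (link i q \<bullet> v $ ix (Suc i)) *\<^sub>R link i q" if "i \<le> j" for i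
  proof -
    have "link i q \<bullet> link i v = 0" "v $ ix i = 0"
      using v that assms by (auto simp: fixing_def tangent_def)
    then show ?thesis by (simp add: link_def)
  qed
  then show "v \<in> flag (Suc j) q"
    using v by (auto simp: flag_def fixing_def)
qed

lemma flag_joint_zero_imp_fixing:
  assumes "v \<in> flag j q" "v $ ix j = 0"
  shows "v \<in> fixing j q"
proof -
  \<comment> \<open>The flag equations carry the zero velocity down from joint \<open>j\<close>; for
    \<open>m\<close> beyond \<open>j\<close> the truncated difference stays at joint 0.\<close>
  have "v $ ix (j - m) = 0" for m
  proof (induction m)
    case (Suc m)
    have rec: "j - Suc m < j \<Longrightarrow> v $ ix (j - Suc m) = (link (j - Suc m) q \<bullet> v $ ix (Suc (j - Suc m))) *\<^sub>R link (j - Suc m) q"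
      using assms(1) by (auto simp: flag_def)
    show ?case
    proof (cases "m < j")
      case True
      then have "Suc (j - Suc m) = j - m" by simp
      then show ?thesis using rec Suc True by simp
    next
      case False
      then show ?thesis using Suc by simp
    qed
  qed (use assms in simp)
  then have "v $ ix i = 0" if "i \<le> j" for i
    by (metis diff_diff_cancel that)
  then show ?thesis using assms by (auto simp: fixing_def flag_def)
qed

text \<open>\<open>descend j a q m\<close> is the velocity of joint \<open>n + 1 - m\<close> when \<open>a\<close> is projected onto
  \<open>flag j q\<close> from the last joint down: the prescribed velocity \<open>b\<close> of joint \<open>n - m\<close> is corrected
  along the link so that the length of the link is preserved.\<close>

primrec descend :: "nat \<Rightarrow> (real^'d)^'m \<Rightarrow> (real^'d)^'m \<Rightarrow> nat \<Rightarrow> real^'d" where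
  "descend j a q 0 = a $ ix (Suc n)"
| "descend j a q (Suc m) = (let b = if n - m < j then 0 else a $ ix (n - m) in
     b + (link (n - m) q \<bullet> (descend j a q m - b)) *\<^sub>R link (n - m) q)"

definition flag_field :: "nat \<Rightarrow> (real^'d)^'m \<Rightarrow> (real^'d)^'m \<Rightarrow> (real^'d)^'m" where
  "flag_field j a q = assemble (\<lambda>i. descend j a q (Suc n - i))"

lemma flag_field_last: "flag_field j a q $ ix (Suc n) = a $ ix (Suc n)"
  by (simp add: flag_field_def)

text \<open>The recursion rewritten in the index of the joint, whereas \<open>descend\<close> counts
  from the free end.\<close>

lemma flag_field_step:
  fixes i j :: nat and a :: "(real^'d)^'m"
  assumes "i \<le> n"
  defines "b \<equiv> if i < j then 0 else a $ ix i"
  shows "flag_field j a q $ ix i =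
    b + (link i q \<bullet> (flag_field j a q $ ix (Suc i) - b)) *\<^sub>R link i q"
proof -
  have "Suc n - i = Suc (n - i)" "n - (n - i) = i" using assms(1) by auto
  then show ?thesis using assms by (simp add: flag_field_def Let_def)
qed

lemma smooth_on_flag_field: "smooth_on UNIV (flag_field j a)"
proof -
  have "smooth_on UNIV (\<lambda>q. descend j a q m)" for m
  proof (induction m)
    case (Suc m)
    have "smooth_on UNIV (\<lambda>q. b + (link (n - m) q \<bullet> (descend j a q m - b)) *\<^sub>R link (n - m) q)" for b
      by (intro smooth_on_add smooth_on_const smooth_on_scaleR smooth_on_inner smooth_on_diff
          smooth_on_link Suc open_UNIV)
    then show ?case by (simp add: Let_def)
  qed (simp add: smooth_on_const)
  then have "smooth_on UNIV (\<lambda>q. assemble (\<lambda>i. descend j a q (Suc n - i)))"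
    by (intro smooth_on_assemble) auto
  then show ?thesis by (simp add: flag_field_def[abs_def])
qed

text \<open>As links have unit length, the correction makes the components of neighbouring
  velocities along the link equal. Below \<open>j\<close> the uncorrected velocity is 0 and the
  recursion is the flag equation itself.\<close>

lemma flag_field_in_flag:
  assumes "q \<in> C" "j \<le> Suc n"
  shows "flag_field j a q \<in> flag j q"
proof -
  have "link i q \<bullet> link i (flag_field j a q) = 0" if "i \<le> n" for i
    using flag_field_step[OF that, of j a q] inner_link_self[OF assms(1) that]
    by (auto simp: link_def[of i "flag_field j a q"] inner_simps)
  moreover have "flag_field j a q $ ix i =
      (link i q \<bullet> flag_field j a q $ ix (Suc i)) *\<^sub>R link i q" if "i < j" for i
    using flag_field_step[of i j a q] assms(2) that by auto
  ultimately show ?thesis by (simp add: flag_def tangent_def)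
qed

text \<open>A vector already in the flag needs no correction at any joint. Hence it extends to the
  global field \<open>flag_field j a\<close>.\<close>

lemma flag_field_id:
  assumes "a \<in> flag j q"
  shows "flag_field j a q = a"
proof (rule joints_eqI)
  fix i assume "i \<le> Suc n"
  have "flag_field j a q $ ix (Suc n - m) = a $ ix (Suc n - m)" for m
  proof (induction m)
    case (Suc m)
    show ?case
    proof (cases "m \<le> n")
      case True
      then have i: "Suc (n - m) = Suc n - m" by simp
      have "link (n - m) q \<bullet> (a $ ix (Suc (n - m)) - a $ ix (n - m)) = 0"
        using assms by (auto simp: flag_def tangent_def link_def)
      moreover have "n - m < j \<Longrightarrow>
          a $ ix (n - m) = (link (n - m) q \<bullet> a $ ix (Suc (n - m))) *\<^sub>R link (n - m) q"
        using assms by (auto simp: flag_def)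
      ultimately show ?thesis
        using flag_field_step[of "n - m" j a q] Suc unfolding i by auto
    next
      case False
      then show ?thesis using Suc by (simp add: not_le)
    qed
  qed (simp add: flag_field_last)
  then show "flag_field j a q $ ix i = a $ ix i"
    by (metis \<open>i \<le> Suc n\<close> diff_diff_cancel)
qed

text \<open>Equal velocities preserve the links between joints \<open>j\<close> and
  \<open>n + 1\<close>, so nothing is corrected there. These are the test fields for brackets, with
  an arbitrary prescribed velocity at joint \<open>j\<close>.\<close>

lemma flag_field_const:
  assumes "j \<le> i" "i \<le> Suc n"
  shows "flag_field j (assemble (\<lambda>_. y)) q $ ix i = y"
  using assms(2,1)
proof (induction rule: inc_induct)
  case base
  then show ?case by (simp add: flag_field_last)
next
  case (step i)
  then show ?case using flag_field_step[of i j "assemble (\<lambda>_. y)" q] by simp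
qed

text \<open>The link velocities of \<open>a\<close> are projected orthogonally to the unit links of
  \<open>q\<close> and added up from joint \<open>j\<close> on; the empty sums keep the joints up to
  \<open>j\<close> at rest.\<close>

definition fixing_field :: "nat \<Rightarrow> (real^'d)^'m \<Rightarrow> (real^'d)^'m \<Rightarrow> (real^'d)^'m" where
  "fixing_field j a q =
     assemble (\<lambda>m. \<Sum>i\<in>{j..<m}. link i a - (link i q \<bullet> link i a) *\<^sub>R link i q)"

lemma smooth_on_fixing_field: "smooth_on UNIV (fixing_field j a)"
  unfolding fixing_field_def[abs_def]
  by (intro smooth_on_assemble smooth_on_sum smooth_on_diff smooth_on_const smooth_on_scaleR
      smooth_on_inner smooth_on_link open_UNIV)

lemma fixing_field_in_fixing:
  assumes "q \<in> C" "j \<le> Suc n"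
  shows "fixing_field j a q \<in> fixing j q"
proof -
  have "link i q \<bullet> link i (fixing_field j a q) = 0" if "i \<le> n" for i
  proof (cases "j \<le> i")
    case True
    then show ?thesis using that inner_link_self[OF assms(1) that]
      by (simp add: fixing_field_def inner_simps)
  next
    case False
    then show ?thesis using that by (simp add: fixing_field_def)
  qed
  then show ?thesis using assms(2) by (simp add: fixing_def tangent_def fixing_field_def)
qed

lemma fixing_field_id:
  assumes "a \<in> fixing j q" "j \<le> Suc n"
  shows "fixing_field j a q = a"
proof (rule joints_eqI)
  fix i assume "i \<le> Suc n"
  then show "fixing_field j a q $ ix i = a $ ix i"
  proof (induction i)
    case 0
    then show ?case using assms by (simp add: fixing_field_def fixing_def)
  next
    case (Suc i)
    show ?case
    proof (cases "j \<le> i")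
      case True
      moreover have "link i q \<bullet> link i a = 0"
        using assms Suc.prems by (simp add: fixing_def tangent_def)
      ultimately show ?thesis
        using Suc by (simp add: fixing_field_def joint_link[of a])
    next
      case False
      then show ?thesis using assms Suc.prems by (simp add: fixing_field_def fixing_def)
    qed
  qed
qed

section \<open>Dimension counts by rank-nullity\<close>

lemma dim_fixing_step:
  fixes q :: "(real^'d)^'m"
  assumes "q \<in> C" "j \<le> n"
  shows "dim (fixing j q) = (CARD('d) - 1) + dim (fixing (Suc j) q)"
proof -
  let ?f = "\<lambda>v::(real^'d)^'m. v $ ix (Suc j)"
  have "linear ?f" using bounded_linear_joint by (rule bounded_linear.linear)
  from dim_eq_image_plus_kernel[OF this subspace_fixing]
  have dim: "dim (fixing j q) = dim (?f ` fixing j q) + dim {v \<in> fixing j q. ?f v = 0}" .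
  \<comment> \<open>With joint \<open>j\<close> at rest, joint \<open>j + 1\<close> can move exactly
    in the hyperplane orthogonal to link \<open>j\<close>.\<close>
  have "?f ` fixing j q = {y. link j q \<bullet> y = 0}"
  proof (intro equalityI subsetI)
    fix y assume "y \<in> ?f ` fixing j q"
    then show "y \<in> {y. link j q \<bullet> y = 0}"
      using assms(2) by (auto simp: fixing_def tangent_def link_def)
  next
    fix y assume y: "y \<in> {y. link j q \<bullet> y = 0}"
    \<comment> \<open>Translating everything beyond joint \<open>j\<close> changes link
      \<open>j\<close> alone.\<close>
    define v where "v = assemble (\<lambda>i. if i \<le> j then 0 else y)"
    have "link i q \<bullet> link i v = 0" if "i \<le> n" for i
      using y that by (cases "i = j") (auto simp: v_def)
    then have "v \<in> fixing j q"
      using assms(2) by (simp add: fixing_def tangent_def v_def)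
    moreover have "?f v = y" using assms(2) by (simp add: v_def)
    ultimately show "y \<in> ?f ` fixing j q" by blast
  qed
  then have "dim (?f ` fixing j q) = CARD('d) - 1"
    using dim_hyperplane[OF link_nonzero[OF assms]] by simp
  moreover have "{v \<in> fixing j q. ?f v = 0} = fixing (Suc j) q"
    by (auto simp: fixing_def le_Suc_eq)
  ultimately show ?thesis using dim by simp
qed

lemma fixing_last: "fixing (Suc n) q = {0}"
proof -
  have "0 \<in> fixing (Suc n) q" using subspace_fixing by (rule subspace_0)
  moreover have "v = 0" if "v \<in> fixing (Suc n) q" for v
    using that by (intro joints_eqI) (simp add: fixing_def)
  ultimately show ?thesis by blast
qed

lemma dim_fixing:
  fixes q :: "(real^'d)^'m"
  assumes "q \<in> C" "j \<le> Suc n"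
  shows "dim (fixing j q) = (Suc n - j) * (CARD('d) - 1)"
  using assms(2)
proof (induction rule: inc_induct)
  case base
  then show ?case by (simp add: fixing_last)
next
  case (step j)
  then have "Suc n - j = Suc (Suc n - Suc j)" by simp
  then show ?case using step dim_fixing_step[OF assms(1), of j] by simp
qed

text \<open>The speed of joint \<open>j + 1\<close> along link \<open>j\<close> is a surjective
  functional. Where it vanishes, joint \<open>j\<close> rests, and with it all lower joints, so the
  kernel is \<open>fixing j q\<close>.\<close>

lemma dim_flag_Suc:
  fixes q :: "(real^'d)^'m"
  assumes "q \<in> C" "j \<le> n"
  shows "dim (flag (Suc j) q) = dim (fixing j q) + 1"
proof -
  let ?f = "\<lambda>v::(real^'d)^'m. link j q \<bullet> v $ ix (Suc j)"
  have "linear ?f"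
    by (intro linearI) (simp_all add: inner_simps)
  from dim_eq_image_plus_kernel[OF this subspace_flag]
  have dim: "dim (flag (Suc j) q) = dim (?f ` flag (Suc j) q) + dim {v \<in> flag (Suc j) q. ?f v = 0}" .
  have "?f ` flag (Suc j) q = UNIV"
  proof (intro equalityI subsetI)
    fix c :: real assume "c \<in> UNIV"
    define v where "v = flag_field (Suc j) (assemble (\<lambda>_. c *\<^sub>R link j q)) q"
    have "v \<in> flag (Suc j) q" unfolding v_def using assms by (intro flag_field_in_flag) auto
    moreover have "?f v = c"
      using assms by (simp add: v_def flag_field_const inner_link_self)
    ultimately show "c \<in> ?f ` flag (Suc j) q" by blast
  qed simp
  moreover have "{v \<in> flag (Suc j) q. ?f v = 0} = fixing j q"
  proof (intro equalityI subsetI)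
    fix v assume v: "v \<in> {v \<in> flag (Suc j) q. ?f v = 0}"
    then have "v \<in> flag j q" "v $ ix j = 0" by (auto simp: flag_def)
    then show "v \<in> fixing j q" by (rule flag_joint_zero_imp_fixing)
  next
    fix v assume v: "v \<in> fixing j q"
    then have "?f v = 0" using assms(2) by (auto simp: fixing_def tangent_def link_def)
    then show "v \<in> {v \<in> flag (Suc j) q. ?f v = 0}"
      using v fixing_subset_flag[OF assms(2)] by auto
  qed
  ultimately show ?thesis using dim by simp
qed

text \<open>Rigid translations are tangent, so the velocity of joint 0 is arbitrary.\<close>

lemma dim_flag_0:
  fixes q :: "(real^'d)^'m"
  shows "dim (flag 0 q) = CARD('d) + dim (fixing 0 q)"
proof -
  let ?f = "\<lambda>v::(real^'d)^'m. v $ ix 0"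
  have "linear ?f" using bounded_linear_joint by (rule bounded_linear.linear)
  from dim_eq_image_plus_kernel[OF this subspace_flag]
  have dim: "dim (flag 0 q) = dim (?f ` flag 0 q) + dim {v \<in> flag 0 q. ?f v = 0}" .
  have "y \<in> ?f ` flag 0 q" for y
  proof -
    have "assemble (\<lambda>_. y) \<in> flag 0 q" by (simp add: flag_def tangent_def)
    moreover have "?f (assemble (\<lambda>_. y)) = y" by simp
    ultimately show ?thesis by (metis image_eqI)
  qed
  then have "?f ` flag 0 q = UNIV" by blast
  moreover have "{v \<in> flag 0 q. ?f v = 0} = fixing 0 q"
    by (auto simp: flag_def fixing_def)
  ultimately show ?thesis using dim by simp
qed

lemma dim_flag:
  fixes q :: "(real^'d)^'m"
  assumes "q \<in> C" "j \<le> Suc n"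
  shows "dim (flag j q) = (Suc n - j + 1) * (CARD('d) - 1) + 1"
proof (cases j)
  case 0
  obtain k where "CARD('d) = Suc k" using gr0_implies_Suc[of "CARD('d)"] by auto
  then show ?thesis using 0 dim_flag_0[of q] dim_fixing[OF assms(1), of 0] by simp
next
  case (Suc i)
  then have "Suc n - i = Suc n - j + 1" using assms(2) by simp
  then show ?thesis using Suc assms dim_flag_Suc[OF assms(1), of i] dim_fixing[OF assms(1), of i]
    by simp
qed

section \<open>Tangent spaces and submanifolds\<close>

lemma joint_eq_sum: "q $ ix m = q $ ix 0 + (\<Sum>i<m. link i q)"
  by (induction m) (simp_all add: joint_link)

lemma assemble_joints: "assemble (\<lambda>i. v $ ix i) = v"
  by (rule joints_eqI) simp

text \<open>Joint 0 moves on a straight line while each link rotates along a great circle with its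
  prescribed initial velocity. The last conclusion keeps the curve in a leaf when joint 0 has
  velocity 0.\<close>

lemma tangent_realized_by_curve:
  assumes "q \<in> C" "v \<in> tangent q"
  obtains \<gamma> where "smooth_on {-1<..<1} \<gamma>" "\<And>t. \<gamma> t \<in> C" "\<gamma> 0 = q"
    "(\<gamma> has_vector_derivative v) (at 0)" "\<And>t. \<gamma> t $ ix 0 = q $ ix 0 + t *\<^sub>R v $ ix 0"
proof
  define c where "c i = norm (link i v)" for i
  \<comment> \<open>A link of speed \<open>c i = 0\<close> needs no separate definition: the sine
    term vanishes and the link stays constant.\<close>
  define \<omega> where "\<omega> i t = cos (c i * t) *\<^sub>R link i q + sin (c i * t) *\<^sub>R (link i v /\<^sub>R c i)" for i t
  define \<gamma> where "\<gamma> t = assemble (\<lambda>m. (q $ ix 0 + t *\<^sub>R v $ ix 0) + (\<Sum>i<m. \<omega> i t))" for t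
  show "smooth_on {-1<..<1} \<gamma>"
    unfolding \<gamma>_def[abs_def] \<omega>_def
    by (intro smooth_on_assemble smooth_on_add smooth_on_const smooth_on_scaleR smooth_on_id
        smooth_on_sum smooth_on_cos smooth_on_sin open_greaterThanLessThan)
  show "\<gamma> t \<in> C" for t
    unfolding mem_C_iff
  proof (intro allI impI)
    fix i assume i: "i \<le> n"
    have orth: "link i q \<bullet> link i v = 0" using assms(2) i by (simp add: tangent_def)
    have "\<omega> i t \<bullet> \<omega> i t = 1"
    proof (cases "c i = 0")
      case True
      then show ?thesis using inner_link_self[OF assms(1) i] by (simp add: \<omega>_def)
    next
      case False
      define w where "w = link i v /\<^sub>R c i"
      have "norm w = 1" "link i q \<bullet> w = 0"
        using False orth by (simp_all add: w_def c_def)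
      then have "w \<bullet> w = 1" "link i q \<bullet> w = 0" by (simp_all add: norm_eq_1)
      then have "\<omega> i t \<bullet> \<omega> i t = (cos (c i * t))\<^sup>2 + (sin (c i * t))\<^sup>2"
        using inner_link_self[OF assms(1) i] unfolding \<omega>_def w_def[symmetric]
        by (simp add: inner_add_left inner_add_right power2_eq_square inner_commute)
      then show ?thesis by simp
    qed
    then show "norm (link i (\<gamma> t)) = 1"
      using i by (simp add: \<gamma>_def norm_eq_1)
  qed
  show "\<gamma> 0 = q"
    by (rule joints_eqI) (simp add: \<gamma>_def \<omega>_def flip: joint_eq_sum)
  show "\<gamma> t $ ix 0 = q $ ix 0 + t *\<^sub>R v $ ix 0" for t
    by (simp add: \<gamma>_def)
  have \<omega>': "(\<omega> i has_vector_derivative link i v) (at 0)" for i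
  proof -
    have "(\<omega> i has_vector_derivative c i *\<^sub>R (link i v /\<^sub>R c i)) (at 0)"
      unfolding \<omega>_def[abs_def] by (auto intro!: derivative_eq_intros)
    moreover have "c i *\<^sub>R (link i v /\<^sub>R c i) = link i v" by (cases "link i v = 0") (simp_all add: c_def)
    ultimately show ?thesis by simp
  qed
  have "(\<gamma> has_vector_derivative
      assemble (\<lambda>m. (0 + 1 *\<^sub>R v $ ix 0) + (\<Sum>i<m. link i v))) (at 0)"
    unfolding \<gamma>_def[abs_def] assemble_eq_sum
    by (intro has_vector_derivative_sum has_vector_derivative_add has_vector_derivative_const
        bounded_linear.has_vector_derivative[OF bounded_linear_axis] \<omega>'
        bounded_linear.has_vector_derivative[OF bounded_linear_scaleR_left]
        has_vector_derivative_id)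
  moreover have "assemble (\<lambda>m. (0 + 1 *\<^sub>R v $ ix 0) + (\<Sum>i<m. link i v)) = v"
    by (rule joints_eqI) (simp flip: joint_eq_sum)
  ultimately show "(\<gamma> has_vector_derivative v) (at 0)" by simp
qed

lemma has_derivative_link:
  "(f has_derivative f') F \<Longrightarrow> ((\<lambda>x. link i (f x)) has_derivative (\<lambda>x. link i (f' x))) F"
  by (rule bounded_linear.has_derivative[OF bounded_linear_link])

lemma has_derivative_joint:
  fixes f :: "'a::real_normed_vector \<Rightarrow> (real^'d)^'m"
  shows "(f has_derivative f') F \<Longrightarrow> ((\<lambda>x. f x $ ix i) has_derivative (\<lambda>x. f' x $ ix i)) F"
  by (rule bounded_linear.has_derivative[OF bounded_linear_joint])

text \<open>One inclusion differentiates the constant squared link lengths; the other uses the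
  explicit curve.\<close>

lemma tangent_space_C:
  assumes "q \<in> C"
  shows "tangent_space C q = tangent q"
proof (intro equalityI subsetI)
  fix v assume v: "v \<in> tangent_space C q"
  have "link i q \<bullet> link i v = 0" if "i \<le> n" for i
  proof -
    have "link i q \<bullet> link i v + link i v \<bullet> link i q = 0"
      by (rule has_derivative_within_unique_on_tangent[OF
            has_derivative_inner[OF has_derivative_link[OF has_derivative_ident]
              has_derivative_link[OF has_derivative_ident]]
            has_derivative_const[of 1] _ v])
        (simp add: inner_link_self that)
    then show ?thesis by (simp add: inner_commute)
  qed
  then show "v \<in> tangent q" by (simp add: tangent_def)
next
  fix v assume "v \<in> tangent q"
  from tangent_realized_by_curve[OF assms this]
  obtain \<gamma> where "smooth_on {-1<..<1} \<gamma>" "\<And>t. \<gamma> t \<in> C" "\<gamma> 0 = q"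
    "(\<gamma> has_vector_derivative v) (at 0)" by metis
  then show "v \<in> tangent_space C q"
    unfolding tangent_space_def by (intro CollectI exI[of _ \<gamma>] exI[of _ "1::real"]) auto
qed

lemma tangent_space_leaf:
  assumes "q \<in> C"
  defines "N \<equiv> {p \<in> C. p $ ix 0 = q $ ix 0}"
  shows "tangent_space N q = fixing 0 q"
proof (intro equalityI subsetI)
  fix v assume v: "v \<in> tangent_space N q"
  have "N \<subseteq> C" by (auto simp: N_def)
  then have "v \<in> tangent_space C q"
    using v unfolding tangent_space_def by blast
  moreover have "v $ ix 0 = 0"
    by (rule has_derivative_within_unique_on_tangent[OF
          has_derivative_joint[OF has_derivative_ident] has_derivative_const[of "q $ ix 0"] _ v])
      (simp add: N_def)
  ultimately show "v \<in> fixing 0 q"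
    using tangent_space_C[OF assms(1)] by (simp add: fixing_def)
next
  fix v assume v: "v \<in> fixing 0 q"
  then have "v \<in> tangent q" by (simp add: fixing_def)
  from tangent_realized_by_curve[OF assms(1) this]
  obtain \<gamma> where \<gamma>: "smooth_on {-1<..<1} \<gamma>" "\<And>t. \<gamma> t \<in> C" "\<gamma> 0 = q"
    "(\<gamma> has_vector_derivative v) (at 0)" "\<And>t. \<gamma> t $ ix 0 = q $ ix 0 + t *\<^sub>R v $ ix 0" by metis
  moreover have "\<gamma> t \<in> N" for t using \<gamma>(2,5) v by (simp add: N_def fixing_def)
  ultimately show "v \<in> tangent_space N q"
    unfolding tangent_space_def by (intro CollectI exI[of _ \<gamma>] exI[of _ "1::real"]) auto
qed

section \<open>Defining equations of the configuration space and of the leaves\<close>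

lemma length_constraint:
  fixes x :: "(real^'d)^'m"
  shows "smooth_on UNIV (\<lambda>x::(real^'d)^'m. link i x \<bullet> link i x - 1)"
    and "frechet_derivative (\<lambda>x. link i x \<bullet> link i x - 1) (at x) v = 2 * (link i x \<bullet> link i v)"
proof -
  show "smooth_on UNIV (\<lambda>x::(real^'d)^'m. link i x \<bullet> link i x - 1)"
    by (intro smooth_on_diff smooth_on_inner smooth_on_link smooth_on_const open_UNIV)
  have "((\<lambda>x. link i x \<bullet> link i x - 1) has_derivative
      (\<lambda>v. link i x \<bullet> link i v + link i v \<bullet> link i x - 0)) (at x)"
    by (intro has_derivative_diff has_derivative_inner has_derivative_link has_derivative_ident
        has_derivative_const)
  then show "frechet_derivative (\<lambda>x. link i x \<bullet> link i x - 1) (at x) v = 2 * (link i x \<bullet> link i v)"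
    by (subst frechet_derivative_at[symmetric]) (auto simp: inner_commute)
qed

lemma mem_C_iff_inner: "q \<in> C \<longleftrightarrow> (\<forall>i\<le>n. link i q \<bullet> link i q - 1 = 0)"
  by (simp add: mem_C_iff norm_eq_1)

lemma submanifold_C:
  assumes "d + (n + 1) = (n + 2) * CARD('d)"
  shows "submanifold d (C :: ((real^'d)^'m) set)"
proof (rule submanifoldI[where c = "n + 1" and f = "\<lambda>i x. link i x \<bullet> link i x - 1"])
  fix x :: "(real^'d)^'m" and i assume x: "x \<in> C" and i: "i < n + 1"
  \<comment> \<open>Moving the part beyond joint \<open>i\<close> along link \<open>i\<close> varies
    only the \<open>i\<close>-th constraint; the factor 1/2 cancels the 2 from differentiating the
    square.\<close>
  define v where "v = assemble (\<lambda>m. if i < m then (1/2) *\<^sub>R link i x else 0)"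
  have "link j v = (if j = i then (1/2) *\<^sub>R link i x else 0)" if "j < n + 1" for j
    using that by (auto simp: v_def)
  then show "\<exists>v. \<forall>j<n + 1. frechet_derivative (\<lambda>x. link j x \<bullet> link j x - 1) (at x) v =
      (if j = i then 1 else 0)"
    using inner_link_self[OF x, of i] i by (intro exI[of _ v]) (auto simp: length_constraint(2))
qed (use assms in \<open>auto simp: card_joints length_constraint(1) mem_C_iff_inner less_Suc_eq_le\<close>)

lemma submanifold_leaf:
  fixes p :: "real^'d"
  assumes "d + (n + 1 + CARD('d)) = (n + 2) * CARD('d)"
  shows "submanifold d {x \<in> C. x $ ix 0 = p}"
proof -
  obtain e :: "nat \<Rightarrow> real^'d" where e: "bij_betw e {0..<CARD('d)} Basis"
    using ex_bij_betw_nat_finite[of "Basis :: (real^'d) set"] by auto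
  \<comment> \<open>Indices up to \<open>n\<close> are the length constraints; the following
    \<open>CARD('d)\<close> ones are the coordinates of the displacement of joint 0 from
    \<open>p\<close>.\<close>
  define f where "f i x = (if i \<le> n then link i x \<bullet> link i x - 1
    else (x $ ix 0 - p) \<bullet> e (i - Suc n))" for i and x :: "(real^'d)^'m"
  have f1: "f i = (\<lambda>x. link i x \<bullet> link i x - 1)" if "i \<le> n" for i
    using that by (auto simp: f_def)
  have f2: "f i = (\<lambda>x. (x $ ix 0 - p) \<bullet> e (i - Suc n))" if "n < i" for i
    using that by (auto simp: f_def)
  have f2': "frechet_derivative (f i) (at x) v = v $ ix 0 \<bullet> e (i - Suc n)" if "n < i" for i x v
  proof -
    have "(f i has_derivative (\<lambda>v. (v $ ix 0 - 0) \<bullet> e (i - Suc n))) (at x)"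
      unfolding f2[OF that]
      by (intro has_derivative_inner_left has_derivative_diff has_derivative_joint
          has_derivative_ident has_derivative_const)
    from fun_cong[OF frechet_derivative_at[OF this], of v] show ?thesis by simp
  qed
  show ?thesis
  proof (rule submanifoldI[where c = "n + 1 + CARD('d)" and f = f])
    show "d + (n + 1 + CARD('d)) = DIM((real^'d)^'m)"
      using assms by (simp add: card_joints)
    show "smooth_on UNIV (f i)" for i
    proof (cases "i \<le> n")
      case False
      then have "n < i" by simp
      show ?thesis unfolding f2[OF \<open>n < i\<close>]
        by (intro smooth_on_inner smooth_on_diff smooth_on_const open_UNIV
            smooth_on_bounded_linear[OF _ bounded_linear_joint] smooth_on_id)
    qed (simp add: f1 length_constraint(1))
    show "{x \<in> C. x $ ix 0 = p} = {x. \<forall>i<n + 1 + CARD('d). f i x = 0}"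
    proof (intro equalityI subsetI)
      fix x assume "x \<in> {x \<in> C. x $ ix 0 = p}"
      then show "x \<in> {x. \<forall>i<n + 1 + CARD('d). f i x = 0}"
        by (auto simp: f_def mem_C_iff_inner)
    next
      fix x assume x: "x \<in> {x. \<forall>i<n + 1 + CARD('d). f i x = 0}"
      have "x $ ix 0 = p"
      proof (rule euclidean_eqI)
        fix b :: "real^'d" assume "b \<in> Basis"
        then have "b \<in> e ` {0..<CARD('d)}" using bij_betw_imp_surj_on[OF e] by simp
        then obtain r where r: "r < CARD('d)" "b = e r" by auto
        then have "f (Suc n + r) x = 0" using x by simp
        then show "x $ ix 0 \<bullet> b = p \<bullet> b" using r by (simp add: f_def inner_diff_left)
      qed
      moreover have "f i x = 0" if "i \<le> n" for i
        using x that by simp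
      then have "x \<in> C" by (simp add: mem_C_iff_inner f_def)
      ultimately show "x \<in> {x \<in> C. x $ ix 0 = p}" by simp
    qed
    fix x :: "(real^'d)^'m" and i
    assume x: "x \<in> {x \<in> C. x $ ix 0 = p}" and i: "i < n + 1 + CARD('d)"
    show "\<exists>v. \<forall>j<n + 1 + CARD('d). frechet_derivative (f j) (at x) v = (if j = i then 1 else 0)"
    proof (cases "i \<le> n")
      case True
      \<comment> \<open>Joint 0 stays at rest here, so the position constraints do not vary.\<close>
      define v where "v = assemble (\<lambda>m. if i < m then (1/2) *\<^sub>R link i x else 0)"
      have "link j v = (if j = i then (1/2) *\<^sub>R link i x else 0)" if "j \<le> n" for j
        using that by (auto simp: v_def)
      then have "frechet_derivative (f j) (at x) v = (if j = i then 1 else 0)" if "j \<le> n" for j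
        using that x inner_link_self[of x i] by (simp add: f1 length_constraint(2))
      moreover have "frechet_derivative (f j) (at x) v = 0" if "n < j" for j
        using that by (simp add: f2' v_def)
      ultimately show ?thesis using True by (metis not_le)
    next
      case False
      \<comment> \<open>A rigid translation along a basis vector preserves all lengths and varies
        just one coordinate of joint 0.\<close>
      define v where "v = assemble (\<lambda>_. e (i - Suc n))"
      have "frechet_derivative (f j) (at x) v = 0" if "j \<le> n" for j
        using that by (simp add: f1 length_constraint(2) v_def)
      moreover have "frechet_derivative (f j) (at x) v = (if j = i then 1 else 0)"
        if "n < j" "j < n + 1 + CARD('d)" for j
      proof -
        have "e (j - Suc n) \<in> Basis" "e (i - Suc n) \<in> Basis"
          using that False i bij_betwE[OF e] by auto
        moreover have "e (i - Suc n) = e (j - Suc n) \<longleftrightarrow> i - Suc n = j - Suc n"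
          using that False i by (intro inj_on_eq_iff[OF bij_betw_imp_inj_on[OF e]]) auto
        moreover have "i - Suc n = j - Suc n \<longleftrightarrow> j = i" using that False by auto
        ultimately show ?thesis using that by (simp add: f2' v_def inner_Basis)
      qed
      ultimately show ?thesis using False by (metis not_le)
    qed
  qed
qed

section \<open>Inclusions between the subspaces, and their global fields\<close>

lemma flag_antimono: "i \<le> j \<Longrightarrow> flag j q \<subseteq> flag i q"
  by (auto simp: flag_def)

lemma fixing_subset_flag_same: "fixing j q \<subseteq> flag j q" if "j \<le> Suc n" for j
proof (cases "j = Suc n")
  case True
  then show ?thesis using subspace_0[OF subspace_flag] by (simp add: fixing_last)
next
  case False
  then show ?thesis using that fixing_subset_flag[of j q] flag_antimono[of j "Suc j" q] by auto
qed

lemma flag_subset_tangent: "flag j q \<subseteq> tangent q"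
  by (auto simp: flag_def)

lemma fixing_subset_tangent: "fixing j q \<subseteq> tangent q"
  by (auto simp: fixing_def)

lemma flag_field_tangent: "j \<le> Suc n \<Longrightarrow> flag_field j a \<in> tangent_fields C (flag j)"
  by (simp add: tangent_fields_def flag_field_in_flag smooth_on_flag_field
      smooth_on_imp_smooth_map_on)

lemma fixing_field_tangent: "j \<le> Suc n \<Longrightarrow> fixing_field j a \<in> tangent_fields C (fixing j)"
  by (simp add: tangent_fields_def fixing_field_in_fixing smooth_on_fixing_field
      smooth_on_imp_smooth_map_on)

section \<open>Lie brackets\<close>

text \<open>Differentiates the tangency equation of \<open>X\<close>, which holds only on
  \<open>C\<close>, in the tangent direction \<open>v\<close>.\<close>

lemma derivative_tangent_field_link:
  assumes X: "X \<in> tangent_fields C (flag j)" and q: "q \<in> C" and v: "v \<in> tangent q" and i: "i \<le> n"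
  defines "X' \<equiv> frechet_derivative X (at q within C)"
  shows "link i q \<bullet> link i (X' v) = - (link i v \<bullet> link i (X q))"
proof -
  have X': "(X has_derivative X') (at q within C)"
    unfolding X'_def using X q by (intro smooth_map_on_has_derivative) (simp_all add: tangent_fields_def)
  have "link i q \<bullet> link i (X' v) + link i v \<bullet> link i (X q) = 0"
  proof (rule has_derivative_within_unique_on_tangent[OF
          has_derivative_inner[OF has_derivative_link[OF has_derivative_ident]
            has_derivative_link[OF X']]
          has_derivative_const[of 0]])
    show "v \<in> tangent_space C q" using v q by (simp add: tangent_space_C)
  qed (use X i in \<open>auto simp: tangent_fields_def flag_def tangent_def\<close>)
  then show ?thesis by simp
qed

text \<open>The product rule applied to the flag equation of \<open>X\<close> at joint
  \<open>i\<close>.\<close>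

lemma derivative_tangent_field_joint:
  assumes X: "X \<in> tangent_fields C (flag j)" and q: "q \<in> C" and v: "v \<in> tangent q" and i: "i < j"
  defines "X' \<equiv> frechet_derivative X (at q within C)"
  shows "X' v $ ix i = (link i q \<bullet> X q $ ix (Suc i)) *\<^sub>R link i v +
    (link i q \<bullet> X' v $ ix (Suc i) + link i v \<bullet> X q $ ix (Suc i)) *\<^sub>R link i q"
proof -
  have X': "(X has_derivative X') (at q within C)"
    unfolding X'_def using X q by (intro smooth_map_on_has_derivative) (simp_all add: tangent_fields_def)
  show ?thesis
  proof (rule has_derivative_within_unique_on_tangent[OF has_derivative_joint[OF X']
        has_derivative_scaleR[OF
          has_derivative_inner[OF has_derivative_link[OF has_derivative_ident]
            has_derivative_joint[OF X']]
          has_derivative_link[OF has_derivative_ident]]])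
    show "v \<in> tangent_space C q" using v q by (simp add: tangent_space_C)
  qed (use X i in \<open>auto simp: tangent_fields_def flag_def\<close>)
qed

text \<open>The derivatives of the two tangency equations have right-hand sides symmetric in
  \<open>X\<close> and \<open>Y\<close>, which cancel in the bracket.\<close>

lemma lie_bracket_in_tangent:
  assumes "X \<in> tangent_fields C (flag j)" "Y \<in> tangent_fields C (flag j)" "q \<in> C"
  shows "lie_bracket C X Y q \<in> tangent q"
proof -
  have "X q \<in> tangent q" "Y q \<in> tangent q"
    using assms flag_subset_tangent by (fastforce simp: tangent_fields_def)+
  then show ?thesis
    using derivative_tangent_field_link[OF assms(1,3)] derivative_tangent_field_link[OF assms(2,3)]
    by (simp add: tangent_def lie_bracket_def inner_diff_right inner_commute)
qed

lemma lie_bracket_joint: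
  assumes "X \<in> tangent_fields C (flag j)" "Y \<in> tangent_fields C (flag j)" "q \<in> C" "i < j"
  shows "lie_bracket C X Y q $ ix i =
    (link i q \<bullet> lie_bracket C X Y q $ ix (Suc i)) *\<^sub>R link i q +
    (link i q \<bullet> Y q $ ix (Suc i)) *\<^sub>R X q $ ix (Suc i) -
    (link i q \<bullet> X q $ ix (Suc i)) *\<^sub>R Y q $ ix (Suc i)"
proof -
  have fl: "X q \<in> flag j q" "Y q \<in> flag j q"
    using assms by (auto simp: tangent_fields_def)
  then have XYt: "X q \<in> tangent q" "Y q \<in> tangent q" using flag_subset_tangent by blast+
  have "X q $ ix i = (link i q \<bullet> X q $ ix (Suc i)) *\<^sub>R link i q"
    "Y q $ ix i = (link i q \<bullet> Y q $ ix (Suc i)) *\<^sub>R link i q"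
    using fl assms(4) by (auto simp: flag_def)
  then have link: "link i (X q) = X q $ ix (Suc i) - (link i q \<bullet> X q $ ix (Suc i)) *\<^sub>R link i q"
    "link i (Y q) = Y q $ ix (Suc i) - (link i q \<bullet> Y q $ ix (Suc i)) *\<^sub>R link i q"
    by (simp_all add: link_def[of i "X q"] link_def[of i "Y q"])
  \<comment> \<open>Here \<open>u\<close> is link \<open>i\<close>, \<open>x\<close> and
    \<open>y\<close> are the velocities of joint \<open>i + 1\<close>, and \<open>r\<close>,
    \<open>p\<close> are the derivatives of \<open>Y\<close> along \<open>X\<close> and of
    \<open>X\<close> along \<open>Y\<close> there. All multiples of \<open>u\<close> that are
    symmetric in \<open>x\<close> and \<open>y\<close> cancel.\<close>
  have "((u \<bullet> y) *\<^sub>R (x - (u \<bullet> x) *\<^sub>R u) + (u \<bullet> r + (x - (u \<bullet> x) *\<^sub>R u) \<bullet> y) *\<^sub>R u) -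
      ((u \<bullet> x) *\<^sub>R (y - (u \<bullet> y) *\<^sub>R u) + (u \<bullet> p + (y - (u \<bullet> y) *\<^sub>R u) \<bullet> x) *\<^sub>R u) =
      (u \<bullet> (r - p)) *\<^sub>R u + (u \<bullet> y) *\<^sub>R x - (u \<bullet> x) *\<^sub>R y" for u x y p r :: "real^'b"
    by (simp add: inner_diff_left inner_diff_right inner_commute algebra_simps)
  then show ?thesis
    unfolding lie_bracket_def vector_minus_component
      derivative_tangent_field_joint[OF assms(1,3) XYt(2) assms(4)]
      derivative_tangent_field_joint[OF assms(2,3) XYt(1) assms(4)] link .
qed

lemma lie_bracket_in_flag:
  assumes "X \<in> tangent_fields C (flag (Suc j))" "Y \<in> tangent_fields C (flag (Suc j))" "q \<in> C"
  shows "lie_bracket C X Y q \<in> flag j q"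
    and "lie_bracket C X Y q \<in> flag (Suc j) q \<longleftrightarrow>
      (link j q \<bullet> Y q $ ix (Suc j)) *\<^sub>R X q $ ix (Suc j) =
      (link j q \<bullet> X q $ ix (Suc j)) *\<^sub>R Y q $ ix (Suc j)"
proof -
  let ?Z = "lie_bracket C X Y q"
  have "(link i q \<bullet> Y q $ ix (Suc i)) *\<^sub>R X q $ ix (Suc i) =
      (link i q \<bullet> X q $ ix (Suc i)) *\<^sub>R Y q $ ix (Suc i)" if "i < j" for i
  proof -
    \<comment> \<open>Below \<open>j\<close> both velocities are multiples of the same link
      \<open>i + 1\<close>, which makes the two extra terms of the bracket formula equal.\<close>
    have "X q $ ix (Suc i) = (link (Suc i) q \<bullet> X q $ ix (Suc (Suc i))) *\<^sub>R link (Suc i) q"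
      "Y q $ ix (Suc i) = (link (Suc i) q \<bullet> Y q $ ix (Suc (Suc i))) *\<^sub>R link (Suc i) q"
      using assms that by (auto simp: tangent_fields_def flag_def)
    moreover have "(u \<bullet> b *\<^sub>R w) *\<^sub>R a *\<^sub>R w = (u \<bullet> a *\<^sub>R w) *\<^sub>R b *\<^sub>R w"
      for a b :: real and u w :: "real^'b"
      by simp
    ultimately show ?thesis by metis
  qed
  then have *: "?Z $ ix i = (link i q \<bullet> ?Z $ ix (Suc i)) *\<^sub>R link i q" if "i < j" for i
    using lie_bracket_joint[OF assms, of i] that by simp
  then show "?Z \<in> flag j q"
    using lie_bracket_in_tangent[OF assms] by (simp add: flag_def)
  have "?Z \<in> flag (Suc j) q \<longleftrightarrow> ?Z $ ix j = (link j q \<bullet> ?Z $ ix (Suc j)) *\<^sub>R link j q"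
    using * lie_bracket_in_tangent[OF assms] by (auto simp: flag_def less_Suc_eq)
  then show "?Z \<in> flag (Suc j) q \<longleftrightarrow>
      (link j q \<bullet> Y q $ ix (Suc j)) *\<^sub>R X q $ ix (Suc j) =
      (link j q \<bullet> X q $ ix (Suc j)) *\<^sub>R Y q $ ix (Suc j)"
    using lie_bracket_joint[OF assms, of j] by (auto simp: algebra_simps)
qed

text \<open>For the harder inclusion, the bracket of two test fields matches joint \<open>j\<close>
  of a given \<open>v\<close> up to a multiple of link \<open>j\<close>; the remainder already lies
  in \<open>flag (Suc j) q\<close>.\<close>

lemma bracket_dist_flag:
  fixes q :: "(real^'d)^'m"
  assumes q: "q \<in> C" and j: "j \<le> n"
  shows "bracket_dist C (flag (Suc j)) q = flag j q"
proof (intro equalityI)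
  show "bracket_dist C (flag (Suc j)) q \<subseteq> flag j q"
    unfolding bracket_dist_def
    using q lie_bracket_in_flag(1)[of _ j _ q] flag_antimono[of j "Suc j" q]
    by (intro span_minimal subspace_flag) (auto simp: tangent_fields_def)
  show "flag j q \<subseteq> bracket_dist C (flag (Suc j)) q"
  proof
    fix v assume v: "v \<in> flag j q"
    \<comment> \<open>\<open>X\<close> carries the wanted velocity at joint \<open>j + 1\<close>,
      and \<open>Y\<close> the unit link, so that the coefficient of \<open>X\<close> in the bracket
      formula is 1.\<close>
    define X where "X = flag_field (Suc j) (assemble (\<lambda>_. v $ ix j))"
    define Y where "Y = flag_field (Suc j) (assemble (\<lambda>_. link j q))"
    define Z where "Z = lie_bracket C X Y q"
    have XY: "X \<in> tangent_fields C (flag (Suc j))" "Y \<in> tangent_fields C (flag (Suc j))"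
      unfolding X_def Y_def using j by (simp_all add: flag_field_tangent)
    have "X q $ ix (Suc j) = v $ ix j" "Y q $ ix (Suc j) = link j q"
      unfolding X_def Y_def using j by (simp_all add: flag_field_const)
    then have Zj: "Z $ ix j = (link j q \<bullet> Z $ ix (Suc j)) *\<^sub>R link j q + v $ ix j -
        (link j q \<bullet> v $ ix j) *\<^sub>R link j q"
      using lie_bracket_joint[OF XY q, of j] inner_link_self[OF q j] by (simp add: Z_def)
    define s where "s = link j q \<bullet> v $ ix j - link j q \<bullet> Z $ ix (Suc j)"
    define W where "W = v - Z"
    have s: "W $ ix j = s *\<^sub>R link j q"
      unfolding W_def vector_minus_component Zj s_def by (simp add: scaleR_left_diff_distrib)
    have vZ: "W \<in> flag j q"
      using v lie_bracket_in_flag(1)[OF XY q] subspace_diff[OF subspace_flag] by (simp add: W_def Z_def)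
    \<comment> \<open>Tangency at link \<open>j\<close> identifies \<open>s\<close> with the
      coefficient required by the one missing flag equation for \<open>W\<close>.\<close>
    then have "link j q \<bullet> link j W = 0" using j by (simp add: flag_def tangent_def)
    then have "link j q \<bullet> W $ ix (Suc j) = s"
      using s inner_link_self[OF q j] by (simp add: link_def[of j "W"] inner_diff_right)
    then have "W \<in> flag (Suc j) q"
      using vZ s by (auto simp: flag_def less_Suc_eq)
    then have "flag_field (Suc j) W q = W" by (rule flag_field_id)
    moreover have "flag_field (Suc j) W \<in> tangent_fields C (flag (Suc j))"
      using j by (simp add: flag_field_tangent)
    ultimately have "W \<in> bracket_dist C (flag (Suc j)) q"
      unfolding bracket_dist_def by (intro span_base UnI1) (metis (mono_tags, lifting) mem_Collect_eq)
    moreover have "Z \<in> bracket_dist C (flag (Suc j)) q"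
      unfolding bracket_dist_def Z_def using XY by (intro span_base UnI2) blast
    ultimately have "W + Z \<in> bracket_dist C (flag (Suc j)) q"
      unfolding bracket_dist_def by (rule span_add)
    then show "v \<in> bracket_dist C (flag (Suc j)) q" by (simp add: W_def)
  qed
qed

text \<open>Testing a characteristic field against every velocity \<open>y\<close> of joint
  \<open>j + 1\<close> forces its own velocity there to vanish. Conversely, a vanishing velocity
  makes both sides of the bracket criterion zero.\<close>

lemma cauchy_char_flag:
  fixes q :: "(real^'d)^'m"
  assumes q: "q \<in> C" and j: "j \<le> n" and d: "CARD('d) \<ge> 2"
  shows "cauchy_char C (flag (Suc j)) q = fixing (Suc j) q"
proof (intro equalityI)
  show "cauchy_char C (flag (Suc j)) q \<subseteq> fixing (Suc j) q"
    unfolding cauchy_char_def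
  proof (intro span_minimal subspace_fixing subsetI)
    fix v assume "v \<in> {X q | X. X \<in> tangent_fields C (flag (Suc j)) \<and>
       (\<forall>Y\<in>tangent_fields C (flag (Suc j)). \<forall>p\<in>C. lie_bracket C X Y p \<in> flag (Suc j) p)}"
    then obtain X where v: "v = X q" and X: "X \<in> tangent_fields C (flag (Suc j))"
      and XY: "\<And>Y. Y \<in> tangent_fields C (flag (Suc j)) \<Longrightarrow> lie_bracket C X Y q \<in> flag (Suc j) q"
      using q by blast
    let ?x = "X q $ ix (Suc j)" and ?u = "link j q"
    have eq: "(?u \<bullet> y) *\<^sub>R ?x = (?u \<bullet> ?x) *\<^sub>R y" for y
    proof -
      let ?Y = "flag_field (Suc j) (assemble (\<lambda>_. y))"
      have Y: "?Y \<in> tangent_fields C (flag (Suc j))" using j by (simp add: flag_field_tangent)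
      show ?thesis
        using lie_bracket_in_flag(2)[OF X Y q] XY[OF Y] j by (simp add: flag_field_const)
    qed
    \<comment> \<open>A nonzero \<open>y\<close> orthogonal to the link removes the component of
      \<open>?x\<close> along it; then \<open>y = ?u\<close> gives \<open>?x = 0\<close>.\<close>
    have "2 \<le> DIM(real^'d)" using d by simp
    then obtain y where y: "y \<noteq> 0" "orthogonal ?u y"
      using orthogonal_to_vector_exists by blast
    then have "?u \<bullet> ?x = 0" using eq[of y] by (simp add: orthogonal_def)
    then have "?x = 0" using eq[of ?u] inner_link_self[OF q j] by simp
    then show "v \<in> fixing (Suc j) q"
      using flag_joint_zero_imp_fixing[of "X q" "Suc j" q] X q v by (auto simp: tangent_fields_def)
  qed
  show "fixing (Suc j) q \<subseteq> cauchy_char C (flag (Suc j)) q"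
  proof
    fix v assume v: "v \<in> fixing (Suc j) q"
    let ?X = "fixing_field (Suc j) v"
    have fixing: "?X \<in> tangent_fields C (fixing (Suc j))"
      using j by (simp add: fixing_field_tangent)
    then have X: "?X \<in> tangent_fields C (flag (Suc j))"
      using fixing_subset_flag_same[of "Suc j"] j by (fastforce simp: tangent_fields_def)
    have "lie_bracket C ?X Y p \<in> flag (Suc j) p"
      if "Y \<in> tangent_fields C (flag (Suc j))" "p \<in> C" for Y p
    proof -
      have "?X p $ ix (Suc j) = 0"
        using fixing that(2) by (auto simp: tangent_fields_def fixing_def)
      then show ?thesis using lie_bracket_in_flag(2)[OF X that] by simp
    qed
    moreover have "?X q = v" using v j by (simp add: fixing_field_id)
    ultimately show "v \<in> cauchy_char C (flag (Suc j)) q"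
      unfolding cauchy_char_def using X
      by (intro span_base CollectI exI[of _ ?X]) auto
  qed
qed

section \<open>Verification of the flag axioms\<close>

lemma distribution_on_flag:
  assumes "j \<le> Suc n"
  shows "distribution_on (C :: ((real^'d)^'m) set) ((Suc n - j + 1) * (CARD('d) - 1) + 1) (flag j)"
proof (rule distribution_onI)
  fix q v :: "(real^'d)^'m" assume "q \<in> C" "v \<in> flag j q"
  then show "\<exists>X\<in>tangent_fields C (flag j). X q = v"
    using flag_field_tangent[OF assms, of v] flag_field_id by blast
qed (use assms in \<open>simp add: subspace_flag tangent_space_C flag_subset_tangent dim_flag\<close>)

lemma distribution_on_fixing:
  assumes "j \<le> Suc n"
  shows "distribution_on (C :: ((real^'d)^'m) set) ((Suc n - j) * (CARD('d) - 1)) (fixing j)"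
proof (rule distribution_onI)
  fix q v :: "(real^'d)^'m" assume "q \<in> C" "v \<in> fixing j q"
  then show "\<exists>X\<in>tangent_fields C (fixing j). X q = v"
    using fixing_field_tangent[OF assms, of v] fixing_field_id[OF _ assms] by blast
qed (use assms in \<open>simp add: subspace_fixing tangent_space_C fixing_subset_tangent dim_fixing\<close>)

lemma special_flag_flag:
  assumes k: "CARD('d) = Suc k" and "k \<ge> 1"
  shows "special_flag k (Suc n) (C :: ((real^'d)^'m) set) flag"
  unfolding special_flag_def
proof (intro conjI ballI allI impI exI)
  show "submanifold ((Suc n + 1) * k + 1) (C :: ((real^'d)^'m) set)"
    by (rule submanifold_C) (simp add: k)
  show "flag 0 q = tangent_space C q" if "q \<in> C" for q :: "(real^'d)^'m"
    using that by (simp add: tangent_space_C flag_def)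
  show "flag j q \<subseteq> flag (j - 1) q" for j and q :: "(real^'d)^'m"
    by (simp add: flag_antimono)
  show "flag (j - 1) q = bracket_dist C (flag j) q" if "j \<in> {1..Suc n}" "q \<in> C"
    for j and q :: "(real^'d)^'m"
    using that bracket_dist_flag[OF that(2), of "j - 1"] by (cases j) auto
  show "distribution_on (C :: ((real^'d)^'m) set) ((Suc n - j + 1) * k + 1) (flag j)"
    if "j \<le> Suc n" for j
    using distribution_on_flag[OF that, where 'd = 'd] k by simp
  fix q :: "(real^'d)^'m" assume q: "q \<in> C"
  \<comment> \<open>The range includes the last index \<open>n + 1\<close>, where
    \<open>fixing\<close> is zero.\<close>
  have cc: "cauchy_char C (flag j) q = fixing j q" if "1 \<le> j" "j \<le> Suc n" for j
    using that cauchy_char_flag[OF q, of "j - 1"] assms by (cases j) auto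
  show "cauchy_char C (flag j) q \<subseteq> flag (j + 1) q"
    "dim (cauchy_char C (flag j) q) + 1 = dim (flag (j + 1) q)" if "j \<in> {1..<Suc n}" for j
    using that fixing_subset_flag[of j q] dim_flag_Suc[OF q, of j] by (simp_all add: cc)
  show "cauchy_char C (flag (Suc n)) q = {0}" by (simp add: cc fixing_last)
  show "fixing 0 q \<subseteq> flag 1 q" "dim (fixing 0 q) + 1 = dim (flag 1 q)"
    using fixing_subset_flag[of 0 q] dim_flag_Suc[OF q, of 0] by simp_all
next
  \<comment> \<open>The integrable subdistribution is \<open>fixing 0\<close>; its leaf through
    \<open>q\<close> consists of the configurations with the same joint 0.\<close>
  show "distribution_on (C :: ((real^'d)^'m) set) (Suc n * k) (fixing 0)"
    using distribution_on_fixing[of 0, where 'd = 'd] k by simp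
  show "completely_integrable (C :: ((real^'d)^'m) set) (Suc n * k) (fixing 0)"
    unfolding completely_integrable_def
  proof
    fix q :: "(real^'d)^'m" assume q: "q \<in> C"
    let ?N = "{p \<in> C. p $ ix 0 = q $ ix 0}"
    have "submanifold (Suc n * k) ?N"
      by (rule submanifold_leaf) (simp add: k)
    moreover have "tangent_space ?N p = fixing 0 p" if "p \<in> ?N" for p
      using that tangent_space_leaf[of p] by simp
    ultimately show "\<exists>N. q \<in> N \<and> N \<subseteq> C \<and> submanifold (Suc n * k) N \<and>
        (\<forall>p\<in>N. tangent_space N p = fixing 0 p)"
      using q by (intro exI[of _ ?N]) auto
  qed
qed

section \<open>Identification of the last flag member with the arm distribution\<close>

lemma axis_eq_sum_coord_field: "axis m w = (\<Sum>r\<in>UNIV. w $ r *\<^sub>R coord_field m r)"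
proof -
  have "(\<Sum>r\<in>UNIV. w $ r *\<^sub>R coord_field m r) = (\<Sum>r\<in>UNIV. axis m (axis r (w $ r)))"
    by (intro sum.cong) (auto simp: coord_field_def axis_def vec_eq_iff)
  also have "\<dots> = axis m (\<Sum>r\<in>UNIV. axis r (w $ r))"
    by (rule linear_sum[OF bounded_linear.linear[OF bounded_linear_axis], symmetric])
  also have "(\<Sum>r\<in>UNIV. axis r (w $ r)) = w"
    by (simp add: vec_eq_iff axis_def if_distrib cong: if_cong)
  finally show ?thesis by simp
qed

lemma arm_Z_eq_axis: "arm_Z ix i q = axis (ix i) (link i q)"
  by (simp add: axis_eq_sum_coord_field arm_Z_def link_def)

lemma joint_in_span_link:
  assumes "v \<in> arm_E n ix q" "i \<le> n"
  shows "v $ ix i \<in> span {link i q}"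
proof -
  let ?S = "{v. v $ ix i \<in> span {link i q}}"
  have "subspace ?S"
    by (auto simp: subspace_def intro: span_add span_scale span_zero)
  moreover have "arm_Z ix l q \<in> ?S" if "l \<le> n" for l
    using that assms(2) by (auto simp: arm_Z_eq_axis axis_def ix_eq_iff intro: span_base span_zero)
  moreover have "coord_field (ix (n + 1)) r \<in> ?S" for r
    using assms(2) by (auto simp: coord_field_def axis_def ix_eq_iff intro: span_zero)
  ultimately have "arm_E n ix q \<subseteq> ?S"
    unfolding arm_E_def by (intro span_minimal) auto
  then show ?thesis using assms(1) by auto
qed

text \<open>Membership in \<open>arm_E\<close> makes the velocity of every joint but the last
  parallel to its link; tangency then fixes the coefficient as in the flag equations.\<close>

lemma flag_last_eq_arm_dist:
  assumes "q \<in> C"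
  shows "flag (Suc n) q = arm_dist n ix q"
proof (intro equalityI subsetI)
  fix v assume v: "v \<in> flag (Suc n) q"
  have Z: "axis (ix i) (v $ ix i) \<in> arm_E n ix q" if "i \<le> n" for i
  proof -
    have "v $ ix i = (link i q \<bullet> v $ ix (Suc i)) *\<^sub>R link i q"
      using v that by (simp add: flag_def)
    then have "axis (ix i) (v $ ix i) = (link i q \<bullet> v $ ix (Suc i)) *\<^sub>R arm_Z ix i q"
      using linear_scale[OF bounded_linear.linear[OF bounded_linear_axis]] arm_Z_eq_axis by metis
    moreover have "arm_Z ix i q \<in> arm_E n ix q"
      unfolding arm_E_def using that by (intro span_base) auto
    ultimately show ?thesis
      unfolding arm_E_def by (simp add: span_scale)
  qed
  moreover have "axis (ix (Suc n)) (v $ ix (Suc n)) \<in> arm_E n ix q"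
    unfolding axis_eq_sum_coord_field arm_E_def
    by (intro span_sum span_scale span_base) auto
  ultimately have "(\<Sum>i\<le>Suc n. axis (ix i) (v $ ix i)) \<in> arm_E n ix q"
    unfolding arm_E_def by (intro span_sum) (auto simp: le_Suc_eq)
  then have "v \<in> arm_E n ix q"
    using assemble_eq_sum[of "\<lambda>i. v $ ix i"] by (simp add: assemble_joints)
  then show "v \<in> arm_dist n ix q"
    using v assms flag_subset_tangent by (auto simp: arm_dist_def tangent_space_C)
next
  fix v assume "v \<in> arm_dist n ix q"
  then have v: "v \<in> tangent q" "v \<in> arm_E n ix q"
    using assms by (auto simp: arm_dist_def tangent_space_C)
  have "v $ ix i = (link i q \<bullet> v $ ix (Suc i)) *\<^sub>R link i q" if i: "i \<le> n" for i
  proof -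
    obtain c where c: "v $ ix i = c *\<^sub>R link i q"
      using joint_in_span_link[OF v(2) i] by (auto simp: span_singleton)
    have "link i q \<bullet> link i v = 0" using v(1) i by (simp add: tangent_def)
    then have "link i q \<bullet> v $ ix (Suc i) = c"
      using c inner_link_self[OF assms i] by (simp add: link_def[of i v] inner_diff_right)
    then show ?thesis using c by simp
  qed
  then show "v \<in> flag (Suc n) q" using v by (auto simp: flag_def)
qed

end

theorem theorem3p1:
  fixes n k :: nat
    and ix :: "nat \<Rightarrow> 'm::finite"
    and C :: "((real^'d)^'m) set"
    and \<Delta> :: "(real^'d)^'m \<Rightarrow> ((real^'d)^'m) set"
  assumes "k \<ge> 2" and "n \<ge> 1"
    and "CARD('d) = k + 1"
    and "bij_betw ix {0..n + 1} UNIV"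
    and "C = config_space n ix"
    and "\<Delta> = arm_dist n ix"
  shows "distribution_on C (k + 1) \<Delta> \<and> generates_special_flag k (n + 1) C \<Delta>"
proof -
  interpret arm n ix by standard (rule assms(4))
  \<comment> \<open>The equality is established at points of \<open>C\<close>, which is all that the
    notions on \<open>C\<close> require.\<close>
  have \<Delta>: "flag (Suc n) q = \<Delta> q" if "q \<in> C" for q
    using that flag_last_eq_arm_dist assms(5,6) by simp
  have "distribution_on C (k + 1) (flag (Suc n))"
    using distribution_on_flag[of "Suc n", where 'd = 'd] assms(3,5) by simp
  then have "distribution_on C (k + 1) \<Delta>"
    using distribution_on_cong[of C "flag (Suc n)" \<Delta>] \<Delta> by blast
  moreover have "special_flag k (Suc n) C flag"
    using special_flag_flag[where 'd = 'd] assms(1,3,5) by simp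
  ultimately show ?thesis
    unfolding generates_special_flag_def using \<Delta> by auto
qed

end
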